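(* Let $R$ be a unitary commutative ring, let $G_1^\delta=(V_1,E_1,\delta_{V_1})$ and $G_2^\delta=(V_2,E_2,\delta_{V_2})$ be weighted directed hypergraphs with weights in $R$, and let $f^v,g^v\colon G_1^\delta\to G_2^\delta$ be homotopic vertex-weighted morphisms. Assume that all elements of the set $\mathbb K=\{k\in R\mid k=\delta_{V_1}(v),\ v\in V_1\}$ are invertible in $R$. Let $H_*^{\chi/\mathbf v}$ denote any one of the three homology theories $H_*^{\mathbf{c/v}}$, $H_*^{\mathbf{b/v}}$, $H_*^{2/v}$. Then the induced homomorphisms $$f^v_*,g^v_*\colon H_*^{\chi/\mathbf v}(G_1^\delta,R)\to H_*^{\chi/\mathbf v}(G_2^\delta,R)$$ coincide.
   Context: All hypergraphs and path complexes are finite; $R$ is a unitary commutative ring. Directed hypergraphs. A directed hypergraph $G=(V,E)$ is a finite set $V$ of vertices and a set $E$ of arrows, each arrow being an ordered pair $(A,B)$, written $A\to B$, of disjoint non-empty subsets of $V$, with $V=\bigcup_{(A\to B)\in E}(A\cup B)$. A morphism $f\colon G\to H$ is a pair of maps $f_V\colon V_G\to V_H$, $f_E\colon E_G\to E_H$ with $f_E(A\to B)=(f_V(A)\to f_V(B))$ for all $(A\to B)\in E_G$. A weighted directed hypergraph $G^\delta=(V,E,\delta_V)$ carries a function $\delta_V\colon V\to R$. A morphism $f$ is vertex-weighted if $\delta_{V_H}(f_V(v))=\delta_{V_G}(v)$ for all $v\in V_G$. $\mathbf P_{01}(G)$ is the set of all non-empty subsets of $V_G$ which are the origin $A$ or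 the end $B$ of some arrow $(A\to B)\in E_G$. Homotopy. $I_1$ denotes either of the two digraphs $0\to1$ and $1\to0$ on $\{0,1\}$. The box product $G\Box I_1$ is the directed hypergraph with vertex set $V_G\times\{0,1\}$ and arrows $A\times\{i\}\to B\times\{i\}$ for $(A\to B)\in E_G$, $i\in\{0,1\}$, and $A\times\{i\}\to A\times\{j\}$ for $A\in\mathbf P_{01}(G)$, $(i\to j)$ the arrow of $I_1$. Morphisms $f_0,f_1\colon G\to H$ are one-step homotopic if for one of the two choices of $I_1$ there is a morphism $F\colon G\Box I_1\to H$ with $F|_{G\Box\{0\}}=f_0$, $F|_{G\Box\{1\}}=f_1$. Vertex-weighted morphisms $f,g\colon G^\delta\to H^\delta$ are homotopic if there is a sequence of vertex-weighted morphisms $f=f_0,f_1,\dots,f_n=g\colon G^\delta\to H^\delta$ with consecutive ones one-step homotopic. Weighted path complexes and their homology. A path complex $\Pi=(V,P)$ is a set $V$ with a set $P$ of finite sequences $(i_0\dots i_n)$, $n\geq 0$, of elements of $V$ (paths) such that all $(i)\in P$ and $(i_0\dots i_n)\in P$, $n\ge1$, implies $(i_0\dots i_{n-1}),(i_1\dots i_n)\in P$. For a set $X$, $P_X$ denotes the set of all paths of finite length on $X$. A weighted path complex $\Pi^\delta=(V,P,\delta_V)$ carries $\delta_V\colon V\to R$; a weighted morphism is a map of vertices sending paths to paths and preserving weights. A path is regular if consecutive vertices are distinct. $\mathcal R_n^{reg}(V)$ ($n\ge0$) is the free $R$-module on regular paths $e_{i_0\dots i_n}$ on $V$ (non-regular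 $e_{i_0\dots i_n}$ are set to be $0$), $\mathcal R_n^{reg}(P)$ is the submodule generated by regular paths in $P$, $\mathcal R^{reg}_{-1}=0$. Put $\partial^w_0=0$, $\partial^w_n(e_{i_0\dots i_n})=\sum_{s=0}^n(-1)^s\delta_V(i_s)e_{i_0\dots\widehat{i_s}\dots i_n}$ for $n\ge1$; then $(\partial^w)^2=0$. Put $\Omega_{-1}^w=0$ and $\Omega^w_n(\Pi^\delta)=\{v\in\mathcal R^{reg}_n(P)\mid\partial^wv\in\mathcal R^{reg}_{n-1}(P)\}$ for $n\geq 0$; $H^{\mathbf w}_*(\Pi^\delta)$ is the homology of $(\Omega^w_*,\partial^w)$. A weighted morphism induces homomorphisms by $e_{i_0\dots i_n}\mapsto e_{f(i_0)\dots f(i_n)}$ (zero if the image is not regular). Three path complexes of a directed hypergraph $G=(V,E)$, each with vertex set $V$; when $G^\delta$ is weighted each is weighted by $\delta_V$. (c) $\mathfrak C(G)$: a path $(i_0\dots i_n)\in P_V$ belongs to it iff for each pair of consecutive vertices either $i_k=i_{k+1}$ or there is $(A\to B)\in E$ with $i_k\in A$, $i_{k+1}\in B$. (b) $\mathfrak B(G)$: the concatenation of $p=(i_0\dots i_n)$ and $q=(j_0\dots j_m)$ with $i_n=j_0$ is $p\vee q=(i_0\dots i_nj_1\dots j_m)$. A path belongs to $\mathfrak B(G)$ iff either it lies in $P_C$ for some $C\in\mathbf P_{01}(G)$, or there are arrows $(A_0\to B_0),\dots,(A_r\to B_r)$ in $E$, $r\geq 0$, with $B_i\cap A_{i+1}\neq\emptyset$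 for $0\le i\le r-1$, such that the path equals $p_0\vee v_0w_0\vee p_1\vee v_1w_1\vee p_2\vee\dots\vee p_r\vee v_rw_r\vee p_{r+1}$ with $p_0\in P_{A_0}$, $p_{r+1}\in P_{B_r}$, $v_i\in A_i$, $w_i\in B_i$, $p_i\in P_{B_{i-1}}\cap P_{A_i}$ for $1\le i\le r$, all concatenations being well defined. (2) $\mathfrak H^2\mathfrak E(G)$: a path $(i_0\dots i_n)\in P_V$ belongs to it iff every two consecutive vertices lie in a common set $A\cup B$ with $(A\to B)\in E$. Denote the resulting weighted path complexes by $\mathfrak C^v(G^\delta)$, $\mathfrak B^v(G^\delta)$, $[\mathfrak H^2\mathfrak E]^v(G^\delta)$. Define $H^{\mathbf{c/v}}_*(G^\delta)=H^{\mathbf w}_*(\mathfrak C^v(G^\delta))$, $H^{\mathbf{b/v}}_*(G^\delta)=H^{\mathbf w}_*(\mathfrak B^v(G^\delta))$, $H^{2/v}_*(G^\delta)=H^{\mathbf w}_*([\mathfrak H^2\mathfrak E]^v(G^\delta))$, all with coefficients in $R$. A vertex-weighted morphism $f$ induces weighted morphisms of these path complexes given by $f_V$ on vertices, and hence homomorphisms $f_*^v$. *)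

theory Defs
  imports "HOL-Library.Poly_Mapping" "HOL-Library.FuncSet"
begin

section \<open>Directed hypergraphs and homotopy of morphisms\<close>

record 'a dhg =
  verts :: "'a set"
  arrows :: "('a set \<times> 'a set) set"

definition dir_hypergraph :: "'a dhg \<Rightarrow> bool" where
  "dir_hypergraph G \<longleftrightarrow>
     finite (verts G) \<and>
     (\<forall>(A, B) \<in> arrows G. A \<noteq> {} \<and> B \<noteq> {} \<and> A \<inter> B = {} \<and> A \<subseteq> verts G \<and> B \<subseteq> verts G) \<and>
     verts G = (\<Union>(A, B) \<in> arrows G. A \<union> B)"

definition P01 :: "'a dhg \<Rightarrow> 'a set set" where
  "P01 G = {C. C \<noteq> {} \<and> C \<subseteq> verts G \<and> (\<exists>(A, B) \<in> arrows G. C = A \<or> C = B)}"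

record ('a, 'b) dhg_map =
  vmap :: "'a \<Rightarrow> 'b"
  emap :: "'a set \<times> 'a set \<Rightarrow> 'b set \<times> 'b set"

text \<open>The maps of vertices and arrows are extensional functions, so that HOL equality of two
  morphisms is equality of maps on the vertices and arrows of the source.\<close>

definition dhg_morphism :: "'a dhg \<Rightarrow> 'b dhg \<Rightarrow> ('a, 'b) dhg_map \<Rightarrow> bool" where
  "dhg_morphism G H f \<longleftrightarrow>
     vmap f \<in> verts G \<rightarrow>\<^sub>E verts H \<and>
     emap f \<in> arrows G \<rightarrow>\<^sub>E arrows H \<and>
     (\<forall>(A, B) \<in> arrows G. emap f (A, B) = (vmap f ` A, vmap f ` B))"

definition vertex_weighted_morphism ::
    "'a dhg \<Rightarrow> ('a \<Rightarrow> 'r) \<Rightarrow> 'b dhg \<Rightarrow> ('b \<Rightarrow> 'r) \<Rightarrow> ('a, 'b) dhg_map \<Rightarrow> bool" where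
  "vertex_weighted_morphism G \<delta>G H \<delta>H f \<longleftrightarrow>
     dhg_morphism G H f \<and> (\<forall>v \<in> verts G. \<delta>H (vmap f v) = \<delta>G v)"

text \<open>The digraph \<open>I\<^sub>1\<close> on \<open>{0, 1}\<close> is given by its only arrow \<open>(i, j)\<close>, which is
  \<open>(0, 1)\<close> or \<open>(1, 0)\<close>.\<close>

definition box_I :: "'a dhg \<Rightarrow> nat \<times> nat \<Rightarrow> ('a \<times> nat) dhg" where
  "box_I G a =
     \<lparr>verts = verts G \<times> {0, 1},
      arrows = {(A \<times> {i}, B \<times> {i}) | A B i. (A, B) \<in> arrows G \<and> i \<in> {0, 1}} \<union>
               {(A \<times> {fst a}, A \<times> {snd a}) | A. A \<in> P01 G}\<rparr>"

text \<open>Restriction of a morphism on the box product to \<open>G \<box> {i}\<close>, identified with \<open>G\<close>.\<close>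

definition restrict_end :: "'a dhg \<Rightarrow> nat \<Rightarrow> ('a \<times> nat, 'b) dhg_map \<Rightarrow> ('a, 'b) dhg_map" where
  "restrict_end G i F =
     \<lparr>vmap = (\<lambda>v \<in> verts G. vmap F (v, i)),
      emap = (\<lambda>e \<in> arrows G. emap F (fst e \<times> {i}, snd e \<times> {i}))\<rparr>"

definition one_step_homotopic ::
    "'a dhg \<Rightarrow> 'b dhg \<Rightarrow> ('a, 'b) dhg_map \<Rightarrow> ('a, 'b) dhg_map \<Rightarrow> bool" where
  "one_step_homotopic G H f0 f1 \<longleftrightarrow>
     (\<exists>a \<in> {(0, 1), (1, 0)}. \<exists>F. dhg_morphism (box_I G a) H F \<and>
        restrict_end G 0 F = f0 \<and> restrict_end G 1 F = f1)"

definition vw_homotopic ::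
    "'a dhg \<Rightarrow> ('a \<Rightarrow> 'r) \<Rightarrow> 'b dhg \<Rightarrow> ('b \<Rightarrow> 'r) \<Rightarrow>
     ('a, 'b) dhg_map \<Rightarrow> ('a, 'b) dhg_map \<Rightarrow> bool" where
  "vw_homotopic G \<delta>G H \<delta>H f g \<longleftrightarrow>
     (\<exists>(n::nat) h. h 0 = f \<and> h n = g \<and>
        (\<forall>k\<le>n. vertex_weighted_morphism G \<delta>G H \<delta>H (h k)) \<and>
        (\<forall>k<n. one_step_homotopic G H (h k) (h (Suc k))))"

section \<open>Weighted homology of path complexes\<close>

text \<open>The path \<open>(i\<^sub>0 \<dots> i\<^sub>n)\<close> is the list of its \<open>n + 1\<close> vertices; it is regular iff the list
  satisfies \<^const>\<open>distinct_adj\<close>.\<close>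

definition paths_on :: "'a set \<Rightarrow> 'a list set" where
  "paths_on X = {p. p \<noteq> [] \<and> set p \<subseteq> X}"

definition path_complex :: "'a set \<Rightarrow> 'a list set \<Rightarrow> bool" where
  "path_complex V P \<longleftrightarrow>
     P \<subseteq> paths_on V \<and> (\<forall>v \<in> V. [v] \<in> P) \<and>
     (\<forall>p \<in> P. length p \<ge> 2 \<longrightarrow> butlast p \<in> P \<and> tl p \<in> P)"

text \<open>The vertex set of a path complex is determined by its set \<open>P\<close> of paths, so \<open>P\<close> and the weight
  function are the only data passed to the constructions below. Chains are finitely
  supported functions from paths to the ring. The following is the chain \<open>r e\<^sub>p\<close>, with \<open>e\<^sub>p = 0\<close> for
  non-regular \<open>p\<close>.\<close>

definition elem_chain :: "'r::comm_ring_1 \<Rightarrow> 'a list \<Rightarrow> 'a list \<Rightarrow>\<^sub>0 'r" where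
  "elem_chain r p = (if distinct_adj p then Poly_Mapping.single p r else 0)"

definition reg_chains :: "'a list set \<Rightarrow> nat \<Rightarrow> ('a list \<Rightarrow>\<^sub>0 'r::comm_ring_1) set" where
  "reg_chains P n = {c. Poly_Mapping.keys c \<subseteq> {p \<in> P. length p = Suc n \<and> distinct_adj p}}"

definition wboundary ::
    "('a \<Rightarrow> 'r::comm_ring_1) \<Rightarrow> nat \<Rightarrow> ('a list \<Rightarrow>\<^sub>0 'r) \<Rightarrow> ('a list \<Rightarrow>\<^sub>0 'r)" where
  "wboundary \<delta> n c =
     (if n = 0 then 0
      else \<Sum>p \<in> Poly_Mapping.keys c. \<Sum>s = 0..n.
             elem_chain (Poly_Mapping.lookup c p * ((-1) ^ s * \<delta> (p ! s))) (take s p @ drop (Suc s) p))"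

text \<open>For \<open>n = 0\<close> the condition on the boundary is vacuous, because \<open>\<partial>\<^sub>0 = 0\<close>.\<close>

definition Omega :: "'a list set \<Rightarrow> ('a \<Rightarrow> 'r::comm_ring_1) \<Rightarrow> nat \<Rightarrow> ('a list \<Rightarrow>\<^sub>0 'r) set" where
  "Omega P \<delta> n =
     {c \<in> reg_chains P n. n \<ge> 1 \<longrightarrow> wboundary \<delta> n c \<in> reg_chains P (n - 1)}"

definition wcycles :: "'a list set \<Rightarrow> ('a \<Rightarrow> 'r::comm_ring_1) \<Rightarrow> nat \<Rightarrow> ('a list \<Rightarrow>\<^sub>0 'r) set" where
  "wcycles P \<delta> n = {c \<in> Omega P \<delta> n. wboundary \<delta> n c = 0}"

definition wboundaries :: "'a list set \<Rightarrow> ('a \<Rightarrow> 'r::comm_ring_1) \<Rightarrow> nat \<Rightarrow> ('a list \<Rightarrow>\<^sub>0 'r) set" where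
  "wboundaries P \<delta> n = wboundary \<delta> (Suc n) ` Omega P \<delta> (Suc n)"

definition homologous ::
    "'a list set \<Rightarrow> ('a \<Rightarrow> 'r::comm_ring_1) \<Rightarrow> nat \<Rightarrow> (('a list \<Rightarrow>\<^sub>0 'r) \<times> ('a list \<Rightarrow>\<^sub>0 'r)) set" where
  "homologous P \<delta> n =
     {(c, d). c \<in> wcycles P \<delta> n \<and> d \<in> wcycles P \<delta> n \<and> c - d \<in> wboundaries P \<delta> n}"

definition whomology :: "'a list set \<Rightarrow> ('a \<Rightarrow> 'r::comm_ring_1) \<Rightarrow> nat \<Rightarrow> ('a list \<Rightarrow>\<^sub>0 'r) set set" where
  "whomology P \<delta> n = wcycles P \<delta> n // homologous P \<delta> n"

definition chain_map :: "('a \<Rightarrow> 'b) \<Rightarrow> ('a list \<Rightarrow>\<^sub>0 'r::comm_ring_1) \<Rightarrow> ('b list \<Rightarrow>\<^sub>0 'r)" where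
  "chain_map f c = (\<Sum>p \<in> Poly_Mapping.keys c. elem_chain (Poly_Mapping.lookup c p) (map f p))"

text \<open>The induced map sends the class of a cycle \<open>z\<close> to the class of \<open>chain_map f z\<close>.\<close>

definition hom_induced ::
    "'a list set \<Rightarrow> ('a \<Rightarrow> 'r::comm_ring_1) \<Rightarrow> 'b list set \<Rightarrow> ('b \<Rightarrow> 'r) \<Rightarrow> ('a \<Rightarrow> 'b) \<Rightarrow> nat \<Rightarrow>
     ('a list \<Rightarrow>\<^sub>0 'r) set \<Rightarrow> ('b list \<Rightarrow>\<^sub>0 'r) set" where
  "hom_induced P \<delta> Q \<epsilon> f n = (\<lambda>X \<in> whomology P \<delta> n. homologous Q \<epsilon> n `` (chain_map f ` X))"

section \<open>Path complexes of a directed hypergraph\<close>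

definition pc_C :: "'a dhg \<Rightarrow> 'a list set" where
  "pc_C G = {p \<in> paths_on (verts G).
     successively (\<lambda>x y. x = y \<or> (\<exists>(A, B) \<in> arrows G. x \<in> A \<and> y \<in> B)) p}"

definition pc_H2E :: "'a dhg \<Rightarrow> 'a list set" where
  "pc_H2E G = {p \<in> paths_on (verts G).
     successively (\<lambda>x y. \<exists>(A, B) \<in> arrows G. x \<in> A \<union> B \<and> y \<in> A \<union> B) p}"

text \<open>Concatenation is meaningful only if the last vertex of \<open>p\<close> is the first vertex of \<open>q\<close>.\<close>

definition path_concat :: "'a list \<Rightarrow> 'a list \<Rightarrow> 'a list" (infixl "\<squnion>\<^sub>p" 65) where
  "p \<squnion>\<^sub>p q = p @ tl q"

text \<open>\<open>zigzag p v w k\<close> is \<open>p\<^sub>0 \<or> v\<^sub>0w\<^sub>0 \<or> p\<^sub>1 \<or> \<dots> \<or> v\<^sub>k\<^sub>-\<^sub>1w\<^sub>k\<^sub>-\<^sub>1 \<or> p\<^sub>k\<close>.\<close>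

primrec zigzag :: "(nat \<Rightarrow> 'a list) \<Rightarrow> (nat \<Rightarrow> 'a) \<Rightarrow> (nat \<Rightarrow> 'a) \<Rightarrow> nat \<Rightarrow> 'a list" where
  "zigzag p v w 0 = p 0"
| "zigzag p v w (Suc k) = zigzag p v w k \<squnion>\<^sub>p [v k, w k] \<squnion>\<^sub>p p (Suc k)"

definition block_path ::
    "'a dhg \<Rightarrow> (nat \<Rightarrow> 'a list) \<Rightarrow> (nat \<Rightarrow> 'a) \<Rightarrow> (nat \<Rightarrow> 'a) \<Rightarrow>
     (nat \<Rightarrow> 'a set) \<Rightarrow> (nat \<Rightarrow> 'a set) \<Rightarrow> nat \<Rightarrow> bool" where
  "block_path G p v w A B r \<longleftrightarrow>
     (\<forall>i\<le>r. (A i, B i) \<in> arrows G) \<and>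
     (\<forall>i<r. B i \<inter> A (Suc i) \<noteq> {}) \<and>
     p 0 \<in> paths_on (A 0) \<and> p (Suc r) \<in> paths_on (B r) \<and>
     (\<forall>i\<le>r. v i \<in> A i \<and> w i \<in> B i) \<and>
     (\<forall>i<r. p (Suc i) \<in> paths_on (B i) \<inter> paths_on (A (Suc i))) \<and>
     (\<forall>i\<le>r. last (p i) = v i \<and> hd (p (Suc i)) = w i)"

definition pc_B :: "'a dhg \<Rightarrow> 'a list set" where
  "pc_B G = (\<Union>C \<in> P01 G. paths_on C) \<union>
     {zigzag p v w (Suc r) | p v w r. \<exists>A B. block_path G p v w A B r}"

lemma successively_butlast_tl:
  "successively R p \<Longrightarrow> successively R (butlast p) \<and> successively R (tl p)"
  by (simp add: successively_conv_nth nth_butlast nth_tl)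

lemma paths_on_butlast_tl:
  assumes "p \<in> paths_on X" "length p \<ge> 2"
  shows "butlast p \<in> paths_on X" "tl p \<in> paths_on X"
proof -
  obtain x y q where p: "p = x # y # q"
    using assms(2) by (cases p rule: remdups_adj.cases) simp_all
  then have "butlast p \<noteq> []" "tl p \<noteq> []" by simp_all
  moreover have "set (tl p) \<subseteq> set p" using p by auto
  moreover have "set (butlast p) \<subseteq> set p" by (rule subsetI) (rule in_set_butlastD)
  ultimately show "butlast p \<in> paths_on X" "tl p \<in> paths_on X"
    using assms(1) by (auto simp: paths_on_def)
qed

lemma path_complex_successively: "path_complex V {p \<in> paths_on V. successively R p}"
proof -
  have "[v] \<in> paths_on V" if "v \<in> V" for v
    using that by (simp add: paths_on_def)
  then show ?thesis
    unfolding path_complex_def by (auto simp: paths_on_butlast_tl successively_butlast_tl)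
qed

lemma path_complex_C: "path_complex (verts G) (pc_C G)"
  unfolding pc_C_def by (rule path_complex_successively)

lemma path_complex_H2E: "path_complex (verts G) (pc_H2E G)"
  unfolding pc_H2E_def by (rule path_complex_successively)

lemma dir_hypergraph_arrowD:
  assumes "dir_hypergraph G" "(A, B) \<in> arrows G"
  shows "A \<noteq> {}" "B \<noteq> {}" "A \<inter> B = {}" "A \<subseteq> verts G" "B \<subseteq> verts G" "A \<in> P01 G" "B \<in> P01 G"
proof -
  have "\<forall>(A, B) \<in> arrows G. A \<noteq> {} \<and> B \<noteq> {} \<and> A \<inter> B = {} \<and> A \<subseteq> verts G \<and> B \<subseteq> verts G"
    using assms(1) unfolding dir_hypergraph_def by (elim conjE)
  from bspec[OF this assms(2)]
  show *: "A \<noteq> {}" "B \<noteq> {}" "A \<inter> B = {}" "A \<subseteq> verts G" "B \<subseteq> verts G"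
    by simp_all
  show "A \<in> P01 G" "B \<in> P01 G"
    unfolding P01_def using * assms(2) by auto
qed

lemma dir_hypergraph_vertexE:
  assumes "dir_hypergraph G" "x \<in> verts G"
  obtains A B where "(A, B) \<in> arrows G" "x \<in> A \<union> B"
proof -
  have "verts G = (\<Union>(A, B) \<in> arrows G. A \<union> B)"
    using assms(1) unfolding dir_hypergraph_def by (elim conjE)
  then have "x \<in> (\<Union>(A, B) \<in> arrows G. A \<union> B)" using assms(2) by (rule subst)
  then show thesis using that by blast
qed

lemma dir_hypergraph_box_I:
  assumes G: "dir_hypergraph G" and a: "a \<in> {(0, 1), (1, 0)}"
  shows "dir_hypergraph (box_I G a)"
proof -
  have 1: "A \<noteq> {} \<and> B \<noteq> {} \<and> A \<inter> B = {} \<and> A \<union> B \<subseteq> verts G \<times> {0, 1}"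
    if "(A, B) \<in> arrows (box_I G a)" for A B
  proof -
    from that consider (cyl) A' B' i where
        "A = A' \<times> {i}" "B = B' \<times> {i}" "(A', B') \<in> arrows G" "i \<in> {0, 1}"
      | (step) C where "A = C \<times> {fst a}" "B = C \<times> {snd a}" "C \<noteq> {}" "C \<subseteq> verts G"
      unfolding box_I_def P01_def by auto
    then show ?thesis
    proof cases
      case cyl
      then show ?thesis using dir_hypergraph_arrowD(1-5)[OF G cyl(3)] by auto
    next
      case step
      then show ?thesis using a by auto
    qed
  qed
  have 2: "x \<in> (\<Union>(A, B) \<in> arrows (box_I G a). A \<union> B)" if x: "x \<in> verts G \<times> {0, 1}" for x
  proof -
    obtain v i where vi: "x = (v, i)" "v \<in> verts G" "i \<in> {0, 1}" using x by (rule SigmaE)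
    obtain A B where AB: "(A, B) \<in> arrows G" "v \<in> A \<union> B"
      using dir_hypergraph_vertexE[OF G vi(2)] .
    have "(A \<times> {i}, B \<times> {i}) \<in> arrows (box_I G a)"
      using AB(1) vi(3) unfolding box_I_def by auto
    then show ?thesis by (rule UN_I) (use AB(2) vi(1) in simp)
  qed
  have "(\<Union>(A, B) \<in> arrows (box_I G a). A \<union> B) \<subseteq> verts G \<times> {0, 1}"
  proof (rule UN_least)
    fix e assume "e \<in> arrows (box_I G a)"
    then show "(case e of (A, B) \<Rightarrow> A \<union> B) \<subseteq> verts G \<times> {0, 1}"
      using 1[of "fst e" "snd e"] by (cases e) simp
  qed
  with 2 have "verts (box_I G a) = (\<Union>(A, B) \<in> arrows (box_I G a). A \<union> B)"
    by (simp add: box_I_def subset_antisym subsetI)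
  moreover have "finite (verts (box_I G a))"
  proof -
    have "finite (verts G)" using G unfolding dir_hypergraph_def by (elim conjE)
    then show ?thesis by (simp add: box_I_def)
  qed
  moreover have "\<forall>(A, B) \<in> arrows (box_I G a). A \<noteq> {} \<and> B \<noteq> {} \<and> A \<inter> B = {} \<and>
      A \<subseteq> verts (box_I G a) \<and> B \<subseteq> verts (box_I G a)"
  proof
    fix e assume "e \<in> arrows (box_I G a)"
    moreover have "verts (box_I G a) = verts G \<times> {0, 1}" by (simp add: box_I_def)
    ultimately show "case e of (A, B) \<Rightarrow> A \<noteq> {} \<and> B \<noteq> {} \<and> A \<inter> B = {} \<and>
        A \<subseteq> verts (box_I G a) \<and> B \<subseteq> verts (box_I G a)"
      using 1[of "fst e" "snd e"] by (cases e) simp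
  qed
  ultimately show ?thesis
    unfolding dir_hypergraph_def by (intro conjI)
qed

lemma pc_B_block_pathI: "block_path G p v w A B r \<Longrightarrow> zigzag p v w (Suc r) \<in> pc_B G"
  unfolding pc_B_def by (rule UnI2, rule CollectI, intro exI conjI, rule refl)

lemma pc_B_P01I: "C \<in> P01 G \<Longrightarrow> p \<in> paths_on C \<Longrightarrow> p \<in> pc_B G"
  unfolding pc_B_def by (rule UnI1, rule UN_I)

lemma block_pathD:
  assumes "block_path G p v w A B r"
  shows "i \<le> r \<Longrightarrow> (A i, B i) \<in> arrows G" "p 0 \<in> paths_on (A 0)" "p (Suc r) \<in> paths_on (B r)"
    "i \<le> r \<Longrightarrow> v i \<in> A i" "i \<le> r \<Longrightarrow> w i \<in> B i"
    "i \<le> r \<Longrightarrow> p (Suc i) \<in> paths_on (B i)"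
    "i \<le> r \<Longrightarrow> last (p i) = v i" "i \<le> r \<Longrightarrow> hd (p (Suc i)) = w i"
    "i < r \<Longrightarrow> B i \<inter> A (Suc i) \<noteq> {}" "i < r \<Longrightarrow> p (Suc i) \<in> paths_on (A (Suc i))"
  using assms unfolding block_path_def by (simp_all add: le_less) auto

lemma block_pathI:
  assumes "\<And>i. i \<le> r \<Longrightarrow> (A i, B i) \<in> arrows G" "p 0 \<in> paths_on (A 0)"
    "\<And>i. i \<le> r \<Longrightarrow> v i \<in> A i" "\<And>i. i \<le> r \<Longrightarrow> w i \<in> B i"
    "\<And>i. i \<le> r \<Longrightarrow> p (Suc i) \<in> paths_on (B i)"
    "\<And>i. i \<le> r \<Longrightarrow> last (p i) = v i" "\<And>i. i \<le> r \<Longrightarrow> hd (p (Suc i)) = w i"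
    "\<And>i. i < r \<Longrightarrow> B i \<inter> A (Suc i) \<noteq> {}" "\<And>i. i < r \<Longrightarrow> p (Suc i) \<in> paths_on (A (Suc i))"
  shows "block_path G p v w A B r"
  unfolding block_path_def by (intro conjI allI impI IntI; (rule assms)?; simp)

lemma block_path_nonempty: "block_path G p v w A B r \<Longrightarrow> i \<le> Suc r \<Longrightarrow> p i \<noteq> []"
  using block_pathD(2)[of G p v w A B r] block_pathD(6)[of G p v w A B r "i - 1"] by (cases i) (simp_all add: paths_on_def)

lemma block_path_cong: "(\<And>i. i \<le> k \<Longrightarrow> p i = q i) \<Longrightarrow> zigzag p v w k = zigzag q v w k"
  by (induction k) (auto simp: path_concat_def)

lemma block_path_butlast:
  assumes G: "dir_hypergraph G" and z: "block_path G p v w A B r"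
  shows "butlast (zigzag p v w (Suc r)) \<in> pc_B G"
proof (cases "tl (p (Suc r)) = []")
  case True
  then have eq: "butlast (zigzag p v w (Suc r)) = zigzag p v w r"
    by (simp add: path_concat_def)
  show ?thesis
  proof (cases r)
    case 0
    have "(A 0, B 0) \<in> arrows G" "p 0 \<in> paths_on (A 0)"
      using block_pathD(1)[OF z, of 0] block_pathD(2)[OF z] by simp_all
    then show ?thesis
      using eq 0 pc_B_P01I[OF dir_hypergraph_arrowD(6)[OF G]] by simp
  next
    case (Suc r')
    have "block_path G p v w A B r'"
      by (rule block_pathI) (simp_all add: block_pathD[OF z] Suc)
    from pc_B_block_pathI[OF this] show ?thesis unfolding eq unfolding Suc .
  qed
next
  case False
  define q where "q = p(Suc r := butlast (p (Suc r)))"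
  have q: "\<And>i. i \<le> r \<Longrightarrow> q i = p i" "q (Suc r) = butlast (p (Suc r))"
    by (simp_all add: q_def)
  have l2: "length (p (Suc r)) \<ge> 2" using False by (cases "p (Suc r)") (auto simp: Suc_le_eq)
  have b: "butlast (p (Suc r)) \<in> paths_on (B r)"
    using paths_on_butlast_tl(1)[OF block_pathD(3)[OF z] l2] .
  have h: "hd (butlast (p (Suc r))) = hd (p (Suc r))"
    using l2 by (cases "p (Suc r)") auto
  have "block_path G q v w A B r"
  proof (rule block_pathI)
    fix i assume i: "i \<le> r"
    show "q (Suc i) \<in> paths_on (B i)"
      using b q block_pathD(6)[OF z i] i by (cases "i = r") simp_all
    show "hd (q (Suc i)) = w i"
      using h q block_pathD(8)[OF z i] i by (cases "i = r") simp_all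
  qed (simp_all add: q block_pathD[OF z])
  moreover have "zigzag q v w (Suc r) = butlast (zigzag p v w (Suc r))"
  proof -
    have "zigzag q v w r = zigzag p v w r" by (rule block_path_cong) (rule q)
    moreover have "tl (butlast (p (Suc r))) = butlast (tl (p (Suc r)))" by (simp add: butlast_tl)
    ultimately show ?thesis using False q(2) by (simp add: path_concat_def butlast_append)
  qed
  ultimately show ?thesis by (metis pc_B_block_pathI)
qed

lemma zigzag_shift:
  assumes "p 0 = [v 0]" "\<And>i. i \<le> k \<Longrightarrow> p (Suc i) \<noteq> []" "\<And>i. i \<le> k \<Longrightarrow> hd (p (Suc i)) = w i"
  shows "zigzag p v w (Suc k) = v 0 # zigzag (\<lambda>i. p (Suc i)) (\<lambda>i. v (Suc i)) (\<lambda>i. w (Suc i)) k"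
  using assms
proof (induction k)
  case 0
  have "p (Suc 0) = w 0 # tl (p (Suc 0))" using 0(2)[of 0] 0(3)[of 0] by (metis le_refl list.collapse)
  then show ?case using 0(1) by (simp add: path_concat_def)
next
  case (Suc k)
  have "zigzag p v w (Suc k) = v 0 # zigzag (\<lambda>i. p (Suc i)) (\<lambda>i. v (Suc i)) (\<lambda>i. w (Suc i)) k"
    using Suc by auto
  then show ?case
    by (simp only: zigzag.simps(2)[of p v w "Suc k"] zigzag.simps(2)[of "\<lambda>i. p (Suc i)"] path_concat_def append_Cons)
qed

lemma zigzag_tl0:
  "p 0 \<noteq> [] \<Longrightarrow> tl (zigzag p v w k) = zigzag (p(0 := tl (p 0))) v w k \<and> zigzag p v w k \<noteq> []"
  by (induction k) (auto simp: path_concat_def)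

lemma block_path_tl:
  assumes G: "dir_hypergraph G" and z: "block_path G p v w A B r"
  shows "tl (zigzag p v w (Suc r)) \<in> pc_B G"
proof (cases "tl (p 0) = []")
  case True
  have "last (p 0) = v 0" "p 0 \<noteq> []" using block_pathD(7)[OF z, of 0] block_path_nonempty[OF z, of 0] by simp_all
  then have p0: "p 0 = [v 0]" using True by (cases "p 0") auto
  have eq: "tl (zigzag p v w (Suc r)) =
      zigzag (\<lambda>i. p (Suc i)) (\<lambda>i. v (Suc i)) (\<lambda>i. w (Suc i)) r"
    using zigzag_shift[of p v r w] p0 block_path_nonempty[OF z] block_pathD(8)[OF z] by simp
  show ?thesis
  proof (cases r)
    case 0
    have "(A 0, B 0) \<in> arrows G" "p (Suc 0) \<in> paths_on (B 0)"
      using block_pathD(1)[OF z, of 0] block_pathD(3)[OF z] 0 by simp_all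
    then show ?thesis
      using eq 0 pc_B_P01I[OF dir_hypergraph_arrowD(7)[OF G]] by simp
  next
    case (Suc r')
    have "block_path G (\<lambda>i. p (Suc i)) (\<lambda>i. v (Suc i)) (\<lambda>i. w (Suc i)) (\<lambda>i. A (Suc i)) (\<lambda>i. B (Suc i)) r'"
      by (rule block_pathI) (simp_all add: block_pathD[OF z] Suc)
    from pc_B_block_pathI[OF this] show ?thesis unfolding eq unfolding Suc .
  qed
next
  case False
  have l2: "length (p 0) \<ge> 2" using False by (cases "p 0") (auto simp: Suc_le_eq)
  have b: "tl (p 0) \<in> paths_on (A 0)"
    using paths_on_butlast_tl(2)[OF block_pathD(2)[OF z] l2] .
  define q where "q = p(0 := tl (p 0))"
  have q: "\<And>i. q (Suc i) = p (Suc i)" "q 0 = tl (p 0)"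
    by (simp_all add: q_def)
  have "block_path G q v w A B r"
  proof (rule block_pathI)
    fix i assume i: "i \<le> r"
    show "last (q i) = v i"
      using q block_pathD(7)[OF z i] False by (cases i) (simp_all add: last_tl)
  qed (simp_all add: q b block_pathD[OF z])
  moreover have "tl (zigzag p v w (Suc r)) = zigzag q v w (Suc r)"
    unfolding q_def by (rule conjunct1[OF zigzag_tl0[OF block_path_nonempty[OF z]]]) simp
  ultimately show ?thesis by (metis pc_B_block_pathI)
qed

lemma path_complex_B:
  assumes G: "dir_hypergraph G"
  shows "path_complex (verts G) (pc_B G)"
proof -
  have verts_path: "zigzag p v w (Suc r) \<in> paths_on (verts G)" if z: "block_path G p v w A B r" for p v w A B r
  proof -
    have AB: "A i \<subseteq> verts G \<and> B i \<subseteq> verts G" if "i \<le> r" for i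
    proof -
      have "(A i, B i) \<in> arrows G" using block_pathD(1)[OF z that] .
      then show ?thesis using dir_hypergraph_arrowD(4,5)[OF G] by simp
    qed
    have w: "w i \<in> verts G" if "i \<le> r" for i
      using block_pathD(5)[OF z that] AB[OF that] by blast
    have p: "set (p i) \<subseteq> verts G" if "i \<le> Suc r" for i
    proof -
      have "set (p 0) \<subseteq> A 0" using block_pathD(2)[OF z] unfolding paths_on_def by blast
      moreover have "set (p (Suc j)) \<subseteq> B j" if "j \<le> r" for j
        using block_pathD(6)[OF z that] unfolding paths_on_def by blast
      ultimately show ?thesis using AB[of 0] AB[of "i - 1"] that
        by (cases i) (simp, meson subset_trans, simp, meson subset_trans)
    qed
    have tlp: "set (tl (p i)) \<subseteq> verts G" if "i \<le> Suc r" for i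
      using p[OF that] by (cases "p i") auto
    have "set (zigzag p v w k) \<subseteq> verts G" if "k \<le> Suc r" for k
      using that
    proof (induction k)
      case (Suc k)
      then show ?case using w[of k] tlp[of "Suc k"] by (simp add: path_concat_def)
    qed (use p in simp)
    moreover have "zigzag p v w (Suc r) \<noteq> []"
      by (rule conjunct2[OF zigzag_tl0[OF block_path_nonempty[OF z]]]) simp
    ultimately show ?thesis unfolding paths_on_def by blast
  qed
  have "paths_on C \<subseteq> paths_on (verts G)" if "C \<in> P01 G" for C
    using that unfolding P01_def paths_on_def by blast
  then have "pc_B G \<subseteq> paths_on (verts G)"
    unfolding pc_B_def using verts_path by blast
  moreover have "[x] \<in> pc_B G" if "x \<in> verts G" for x
  proof -
    obtain A B where "(A, B) \<in> arrows G" "x \<in> A \<union> B"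
      using dir_hypergraph_vertexE[OF G \<open>x \<in> verts G\<close>] .
    then obtain C where C: "C \<in> P01 G" "x \<in> C"
      using dir_hypergraph_arrowD(6,7)[OF G] by blast
    then have "[x] \<in> paths_on C" by (simp add: paths_on_def)
    with C(1) show ?thesis by (rule pc_B_P01I)
  qed
  moreover have "butlast p \<in> pc_B G \<and> tl p \<in> pc_B G" if "p \<in> pc_B G" "length p \<ge> 2" for p
  proof -
    from that(1) consider C where "C \<in> P01 G" "p \<in> paths_on C"
      | q v w r A B where "p = zigzag q v w (Suc r)" "block_path G q v w A B r"
      unfolding pc_B_def by blast
    then show ?thesis
    proof cases
      case 1
      then show ?thesis using paths_on_butlast_tl[OF 1(2) that(2)] pc_B_P01I by metis
    next
      case 2
      show ?thesis unfolding 2(1) using block_path_butlast[OF G 2(2)] block_path_tl[OF G 2(2)] by (rule conjI)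
    qed
  qed
  ultimately show ?thesis unfolding path_complex_def by blast
qed
end

theory Submission
  imports Defs HOL.Modules
begin

text \<open>If \<open>F\<close> is a one-step homotopy from \<open>f\<close> to \<open>g\<close> along \<open>0 \<rightarrow> 1\<close>, then
  \<open>L(e\<^bsub>i\<^sub>0\<dots>i\<^sub>n\<^esub>) = \<Sum>\<^sub>s (-1)\<^sup>s \<delta>(i\<^sub>s)\<^sup>-\<^sup>1 e\<^bsub>f(i\<^sub>0)\<dots>f(i\<^sub>s)g(i\<^sub>s)\<dots>g(i\<^sub>n)\<^esub>\<close> satisfies \<open>\<partial>L + L\<partial> = g - f\<close>: the factor
  \<open>\<delta>(i\<^sub>s)\<^sup>-\<^sup>1\<close> cancels the weight of the removed vertices \<open>f(i\<^sub>s)\<close> and \<open>g(i\<^sub>s)\<close>, so that these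
  terms telescope. In each of the three path complexes the prism path
  \<open>f(i\<^sub>0)\<dots>f(i\<^sub>s)g(i\<^sub>s)\<dots>g(i\<^sub>n)\<close> is again allowed: its middle step is provided by the arrow
  \<open>f(C) \<rightarrow> g(C)\<close> for \<open>C \<in> P01 G\<close> with \<open>i\<^sub>s \<in> C\<close>. Homotopies along \<open>1 \<rightarrow> 0\<close> exchange the
  roles of \<open>f\<close> and \<open>g\<close>.\<close>

section \<open>The weighted prism operator\<close>

abbreviation single :: "'p \<Rightarrow> 'r \<Rightarrow> 'p \<Rightarrow>\<^sub>0 'r::comm_ring_1" where
  "single \<equiv> Poly_Mapping.single"

lemma poly_mapping_eq_sum_single: "c = (\<Sum>p \<in> Poly_Mapping.keys c. single p (Poly_Mapping.lookup c p))"
  by (rule poly_mapping_eqI)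
    (simp add: lookup_sum lookup_single sum.delta' in_keys_iff when_def)

text \<open>The coefficient is an argument of \<open>\<phi>\<close>, so that additivity in it takes
  the place of a module structure on chains.\<close>

definition extend :: "('p \<Rightarrow> 'r \<Rightarrow> ('q \<Rightarrow>\<^sub>0 'r)) \<Rightarrow> ('p \<Rightarrow>\<^sub>0 'r) \<Rightarrow> ('q \<Rightarrow>\<^sub>0 'r::comm_ring_1)" where
  "extend \<phi> c = (\<Sum>p \<in> Poly_Mapping.keys c. \<phi> p (Poly_Mapping.lookup c p))"

lemma extend_superset:
  assumes "\<And>p. additive (\<phi> p)" "finite S" "Poly_Mapping.keys c \<subseteq> S"
  shows "extend \<phi> c = (\<Sum>p \<in> S. \<phi> p (Poly_Mapping.lookup c p))"
  unfolding extend_def using assms(2,3)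
  by (rule sum.mono_neutral_left) (simp add: in_keys_iff additive.zero[OF assms(1)])

lemma additive_extend:
  assumes "\<And>p. additive (\<phi> p)"
  shows "additive (extend \<phi>)"
proof
  fix c d :: "'a \<Rightarrow>\<^sub>0 'b"
  let ?S = "Poly_Mapping.keys c \<union> Poly_Mapping.keys d"
  have "Poly_Mapping.keys (c + d) \<subseteq> ?S" by (rule Poly_Mapping.keys_add)
  then show "extend \<phi> (c + d) = extend \<phi> c + extend \<phi> d"
    by (simp add: extend_superset[OF assms, where S = ?S] lookup_add additive.add[OF assms] sum.distrib)
qed

lemma extend_single:
  assumes "\<And>p. additive (\<phi> p)"
  shows "extend \<phi> (single p r) = \<phi> p r"
  by (simp add: extend_def additive.zero[OF assms])

lemma keys_extend:
  assumes "\<And>p r. p \<in> Poly_Mapping.keys c \<Longrightarrow> Poly_Mapping.keys (\<phi> p r) \<subseteq> S"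
  shows "Poly_Mapping.keys (extend \<phi> c) \<subseteq> S"
  unfolding extend_def using Poly_Mapping.keys_sum assms by fast

text \<open>The test on generators is confined to the support of \<open>c\<close>, so facts about
  the vertices occurring in a given chain can enter it.\<close>

lemma additive_eqI:
  assumes "additive S" "additive T"
    and "\<And>p r. p \<in> Poly_Mapping.keys c \<Longrightarrow> S (single p r) = T (single p r)"
  shows "S c = T c"
proof -
  have "S (\<Sum>p \<in> Poly_Mapping.keys c. single p (Poly_Mapping.lookup c p))
      = T (\<Sum>p \<in> Poly_Mapping.keys c. single p (Poly_Mapping.lookup c p))"
    by (simp add: additive.sum[OF assms(1)] additive.sum[OF assms(2)] assms(3))
  then show ?thesis by (simp flip: poly_mapping_eq_sum_single)
qed

lemma additive_single_mult: "additive (\<lambda>r. single p (a * r))"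
  by (simp add: additive_def distrib_left single_add)

lemma additive_single: "additive (single p)"
  by (simp add: additive_def single_add)

lemma additive_elem_chain: "additive (\<lambda>r. elem_chain r p)"
  by (simp add: additive_def elem_chain_def single_add)

section \<open>Chain operators on arbitrary lists\<close>

definition push :: "('p \<Rightarrow> 'q) \<Rightarrow> ('p \<Rightarrow>\<^sub>0 'r) \<Rightarrow> ('q \<Rightarrow>\<^sub>0 'r::comm_ring_1)" where
  "push h = extend (\<lambda>p. single (h p))"

definition smul :: "'r \<Rightarrow> ('p \<Rightarrow>\<^sub>0 'r) \<Rightarrow> ('p \<Rightarrow>\<^sub>0 'r::comm_ring_1)" where
  "smul a = extend (\<lambda>p r. single p (a * r))"

text \<open>The convention that irregular paths are zero, as a projection applied after the
  unrestricted operators.\<close>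

definition reg_part :: "('a list \<Rightarrow>\<^sub>0 'r) \<Rightarrow> ('a list \<Rightarrow>\<^sub>0 'r::comm_ring_1)" where
  "reg_part = extend (\<lambda>p r. elem_chain r p)"

text \<open>All lists serve as generators, the empty one and the irregular ones included: with
  the augmentation \<open>\<partial>e\<^sub>v = \<delta>(v) e\<^bsub>[]\<^esub>\<close>, the recursion on the list and hence the proof of the
  homotopy formula need no special cases. This differs from \<^const>\<open>wboundary\<close> only in
  degree \<open>0\<close> and by irregular terms.\<close>

primrec path_bd :: "('a \<Rightarrow> 'r) \<Rightarrow> 'a list \<Rightarrow> 'r \<Rightarrow> ('a list \<Rightarrow>\<^sub>0 'r::comm_ring_1)" where
  "path_bd \<delta> [] r = 0"
| "path_bd \<delta> (x # p) r = single p (\<delta> x * r) - push ((#) x) (path_bd \<delta> p r)"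

definition bd :: "('a \<Rightarrow> 'r) \<Rightarrow> ('a list \<Rightarrow>\<^sub>0 'r) \<Rightarrow> ('a list \<Rightarrow>\<^sub>0 'r::comm_ring_1)" where
  "bd \<delta> = extend (path_bd \<delta>)"

text \<open>\<open>u\<close> is the inverse of the weight function.\<close>

primrec path_prism ::
    "('a \<Rightarrow> 'b) \<Rightarrow> ('a \<Rightarrow> 'b) \<Rightarrow> ('a \<Rightarrow> 'r) \<Rightarrow> 'a list \<Rightarrow> 'r \<Rightarrow> ('b list \<Rightarrow>\<^sub>0 'r::comm_ring_1)" where
  "path_prism f g u [] r = 0"
| "path_prism f g u (x # p) r =
     single (f x # map g (x # p)) (u x * r) - push ((#) (f x)) (path_prism f g u p r)"

definition prism ::
    "('a \<Rightarrow> 'b) \<Rightarrow> ('a \<Rightarrow> 'b) \<Rightarrow> ('a \<Rightarrow> 'r) \<Rightarrow> ('a list \<Rightarrow>\<^sub>0 'r) \<Rightarrow> ('b list \<Rightarrow>\<^sub>0 'r::comm_ring_1)" where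
  "prism f g u = extend (path_prism f g u)"

lemma additive_push: "additive (push h)"
  unfolding push_def by (intro additive_extend additive_single)

lemma additive_smul: "additive (smul a)"
  unfolding smul_def by (intro additive_extend additive_single_mult)

lemma additive_reg_part: "additive reg_part"
  unfolding reg_part_def by (intro additive_extend additive_elem_chain)

lemma additive_path_bd: "additive (path_bd \<delta> p)"
proof (induction p)
  case (Cons x p)
  then show ?case
    by (simp add: additive_def additive.add[OF additive_push] distrib_left single_add)
qed (simp add: additive_def)

lemma additive_bd: "additive (bd \<delta>)"
  unfolding bd_def by (intro additive_extend additive_path_bd)

lemma additive_path_prism: "additive (path_prism f g u p)"
proof (induction p)
  case (Cons x p)
  then show ?case
    by (simp add: additive_def additive.add[OF additive_push] distrib_left single_add)
qed (simp add: additive_def)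

lemma additive_prism: "additive (prism f g u)"
  unfolding prism_def by (intro additive_extend additive_path_prism)

lemma push_single [simp]: "push h (single p r) = single (h p) r"
  by (simp add: push_def extend_single additive_single)

lemma smul_single [simp]: "smul a (single p r) = single p (a * r)"
  by (simp add: smul_def extend_single additive_single_mult)

lemma reg_part_single [simp]: "reg_part (single p r) = elem_chain r p"
  by (simp add: reg_part_def extend_single additive_elem_chain)

lemma bd_single [simp]: "bd \<delta> (single p r) = path_bd \<delta> p r"
  by (simp add: bd_def extend_single additive_path_bd)

lemma prism_single [simp]: "prism f g u (single p r) = path_prism f g u p r"
  by (simp add: prism_def extend_single additive_path_prism)

lemmas chain_ops_simps [simp] =
  additive_push[THEN additive.add] additive_push[THEN additive.diff] additive_push[THEN additive.zero]
  additive_smul[THEN additive.add] additive_smul[THEN additive.diff] additive_smul[THEN additive.zero]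
  additive_reg_part[THEN additive.add] additive_reg_part[THEN additive.diff] additive_reg_part[THEN additive.zero]
  additive_bd[THEN additive.add] additive_bd[THEN additive.diff] additive_bd[THEN additive.zero]
  additive_prism[THEN additive.add] additive_prism[THEN additive.diff] additive_prism[THEN additive.zero]

lemma push_push: "push h (push k c) = push (h \<circ> k) c"
  by (rule additive_eqI[where S = "\<lambda>c. push h (push k c)"]; simp add: additive_def algebra_simps)

lemma smul_push: "smul a (push h c) = push h (smul a c)"
  by (rule additive_eqI[where S = "\<lambda>c. smul a (push h c)"]; simp add: additive_def algebra_simps)

lemma smul_path_bd: "smul a (path_bd \<delta> p r) = path_bd \<delta> p (a * r)"
  by (induction p) (simp_all add: smul_push algebra_simps)

lemma smul_path_prism: "smul a (path_prism f g u p r) = path_prism f g u p (a * r)"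
  by (induction p) (simp_all add: smul_push algebra_simps)

lemma bd_cons: "bd \<delta> (push ((#) x) c) = smul (\<delta> x) c - push ((#) x) (bd \<delta> c)"
  by (rule additive_eqI[where S = "\<lambda>c. bd \<delta> (push ((#) x) c)"]; simp add: additive_def algebra_simps)

lemma prism_cons:
  "prism f g u (push ((#) x) c) =
     push (\<lambda>p. f x # map g (x # p)) (smul (u x) c) - push ((#) (f x)) (prism f g u c)"
  by (rule additive_eqI[where S = "\<lambda>c. prism f g u (push ((#) x) c)"]; simp add: additive_def algebra_simps)

lemma path_bd_map:
  assumes "\<And>x. x \<in> set p \<Longrightarrow> \<epsilon> (f x) = \<delta> x"
  shows "path_bd \<epsilon> (map f p) r = push (map f) (path_bd \<delta> p r)"
  using assms by (induction p) (simp_all add: push_push comp_def)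

text \<open>Induction on the list. Deleting \<open>f x\<close> or \<open>g x\<close> from the new
  prism path leaves the factor \<open>\<delta> x * u x = 1\<close>: the first deletion gives the
  \<open>g\<close>-image, the second cancels \<open>f x # map g p\<close>, which comes from the
  induction hypothesis with \<open>f x\<close> put in front. All other terms cancel because
  \<open>g\<close> preserves weights and scalars pass through both operators.\<close>

lemma path_prism_homotopy:
  assumes "\<And>x. x \<in> set p \<Longrightarrow> \<epsilon> (f x) = \<delta> x \<and> \<epsilon> (g x) = \<delta> x \<and> \<delta> x * u x = 1"
  shows "bd \<epsilon> (path_prism f g u p r) + prism f g u (path_bd \<delta> p r) =
    single (map g p) r - single (map f p) r"
  using assms
proof (induction p)
  case (Cons x p)
  have w: "\<epsilon> (f x) = \<delta> x" "\<epsilon> (g x) = \<delta> x" "\<delta> x * (u x * r) = r"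
    using Cons.prems[of x] by (simp_all flip: mult.assoc)
  have bdg: "path_bd \<epsilon> (map g p) (u x * r) = push (map g) (path_bd \<delta> p (u x * r))"
    by (rule path_bd_map) (use Cons.prems in simp)
  have IH: "bd \<epsilon> (path_prism f g u p r) =
      single (map g p) r - single (map f p) r - prism f g u (path_bd \<delta> p r)"
    using Cons by (simp add: eq_diff_eq)
  show ?case
    by (simp add: bd_cons prism_cons w bdg IH push_push comp_def smul_path_bd smul_path_prism)
qed simp

section \<open>Descent of the operators to regular chains\<close>

lemma reg_push_cons_reg: "reg_part (push ((#) x) (reg_part c)) = reg_part (push ((#) x) c)"
  by (rule additive_eqI[where S = "\<lambda>c. reg_part (push ((#) x) (reg_part c))"])
    (auto simp: additive_def elem_chain_def dest: distinct_adj_ConsD)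

lemma reg_push_cons_cons: "reg_part (push ((#) x) (push ((#) x) c)) = 0"
  by (rule additive_eqI[where S = "\<lambda>c. reg_part (push ((#) x) (push ((#) x) c))" and T = "\<lambda>c. 0"])
    (simp_all add: elem_chain_def additive_def)

lemma reg_push_cons_eq_0: "reg_part c = 0 \<Longrightarrow> reg_part (push ((#) x) c) = 0"
  using reg_push_cons_reg[of x c] by simp

text \<open>If the list starts with \<open>x\<close> twice, deleting either copy gives the same path
  with the same weight and opposite signs; all other terms keep the repetition. A repetition further
  back is handled by induction.\<close>

lemma reg_path_bd_irregular: "\<not> distinct_adj p \<Longrightarrow> reg_part (path_bd \<delta> p r) = 0"
proof (induction p)
  case (Cons x p)
  show ?case
  proof (cases "distinct_adj p")
    case True
    then obtain q where "p = x # q" using Cons.prems by (cases p) auto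
    then show ?thesis by (simp add: reg_push_cons_cons)
  next
    case False
    then show ?thesis using Cons.IH by (simp add: reg_push_cons_eq_0 elem_chain_def)
  qed
qed simp

text \<open>Unlike for the boundary, nothing cancels here: every prism path over a repetition of
  \<open>x\<close> itself repeats \<open>f x\<close> or \<open>g x\<close>.\<close>

lemma reg_path_prism_irregular: "\<not> distinct_adj p \<Longrightarrow> reg_part (path_prism f g u p r) = 0"
proof (induction p)
  case (Cons x p)
  have *: "\<not> distinct_adj (map g (x # p))"
    using Cons.prems distinct_adj_mapD by blast
  show ?case
  proof (cases "distinct_adj p")
    case True
    then obtain q where "p = x # q" using Cons.prems by (cases p) auto
    then show ?thesis by (simp add: reg_push_cons_cons elem_chain_def)
  next
    case False
    then show ?thesis using Cons.IH * by (auto simp add: reg_push_cons_eq_0 elem_chain_def)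
  qed
qed simp

text \<open>This and the next two facts allow the regular part to be taken once, at the end, so that
  identities between the unrestricted operators project to regular chains.\<close>

lemma reg_bd_reg: "reg_part (bd \<delta> (reg_part c)) = reg_part (bd \<delta> c)"
  by (rule additive_eqI[where S = "\<lambda>c. reg_part (bd \<delta> (reg_part c))"])
    (simp_all add: additive_def elem_chain_def reg_path_bd_irregular)

lemma reg_prism_reg: "reg_part (prism f g u (reg_part c)) = reg_part (prism f g u c)"
  by (rule additive_eqI[where S = "\<lambda>c. reg_part (prism f g u (reg_part c))"])
    (simp_all add: additive_def elem_chain_def reg_path_prism_irregular)

lemma reg_push_map_reg: "reg_part (push (map f) (reg_part c)) = reg_part (push (map f) c)"
  by (rule additive_eqI[where S = "\<lambda>c. reg_part (push (map f) (reg_part c))"])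
    (auto simp add: additive_def elem_chain_def dest: distinct_adj_mapD)


section \<open>Comparison with the alternating-sum boundary, and supports\<close>

lemma path_bd_eq_sum:
  "path_bd \<delta> p r =
     (\<Sum>s<length p. single (take s p @ drop (Suc s) p) (r * ((-1) ^ s * \<delta> (p ! s))))"
proof (induction p)
  case (Cons x p)
  show ?case
    by (simp add: Cons sum.lessThan_Suc_shift additive.sum[OF additive_push] single_uminus sum_negf mult.commute
        del: sum.lessThan_Suc)
qed simp

text \<open>Degree 0 is excluded because there \<open>bd\<close> yields multiples of the empty path
  while \<open>wboundary\<close> is zero.\<close>

lemma wboundary_eq:
  assumes "\<And>p. p \<in> Poly_Mapping.keys c \<Longrightarrow> length p = Suc n" "0 < n"
  shows "wboundary \<delta> n c = reg_part (bd \<delta> c)"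
proof -
  have "(\<Sum>s = 0..n. elem_chain (r * ((-1) ^ s * \<delta> (p ! s))) (take s p @ drop (Suc s) p)) =
      reg_part (path_bd \<delta> p r)"
    if "length p = Suc n" for p r
    unfolding path_bd_eq_sum that additive.sum[OF additive_reg_part]
    by (simp add: atLeast0AtMost lessThan_Suc_atMost)
  then show ?thesis
    using assms by (simp add: wboundary_def bd_def extend_def additive.sum[OF additive_reg_part])
qed

lemma chain_map_eq: "chain_map f c = reg_part (push (map f) c)"
  by (simp add: chain_map_def push_def extend_def additive.sum[OF additive_reg_part])

lemma keys_reg_part: "Poly_Mapping.keys (reg_part c) \<subseteq> {p \<in> Poly_Mapping.keys c. distinct_adj p}"
  unfolding reg_part_def by (rule keys_extend) (auto simp: elem_chain_def)

lemma keys_push: "Poly_Mapping.keys (push h c) \<subseteq> h ` Poly_Mapping.keys c"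
  unfolding push_def by (rule keys_extend) auto

lemma keys_diff_subset:
  "Poly_Mapping.keys a \<subseteq> S \<Longrightarrow> Poly_Mapping.keys b \<subseteq> S \<Longrightarrow> Poly_Mapping.keys (a - b) \<subseteq> S"
  using Poly_Mapping.keys_diff[of a b] by blast

text \<open>Reduces admissibility of the prism chain to a condition on single paths. The leading
  term of the recursion has empty \<open>l\<close>; the remaining ones prepend \<open>x\<close> to
  \<open>l\<close>.\<close>

lemma keys_path_prism:
  "Poly_Mapping.keys (path_prism f g u p r) \<subseteq>
     {map f (l @ [x]) @ map g (x # m) | l x m. p = l @ x # m}" (is "_ \<subseteq> ?S p")
proof (induction p)
  case (Cons x p)
  have "f x # map g (x # p) \<in> ?S (x # p)"
    by (rule CollectI, rule exI[of _ "[]"]) simp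
  moreover have "(#) (f x) ` ?S p \<subseteq> ?S (x # p)"
  proof
    fix q assume "q \<in> (#) (f x) ` ?S p"
    then obtain l y m where "q = f x # map f (l @ [y]) @ map g (y # m)" "p = l @ y # m" by blast
    then show "q \<in> ?S (x # p)"
      by (intro CollectI exI[of _ "x # l"] exI[of _ y] exI[of _ m]) simp
  qed
  then have "Poly_Mapping.keys (push ((#) (f x)) (path_prism f g u p r)) \<subseteq> ?S (x # p)"
    by (rule subset_trans[OF subset_trans[OF keys_push image_mono[OF Cons.IH]]])
  ultimately show ?case
    unfolding path_prism.simps by (intro keys_diff_subset) auto
qed simp

section \<open>The subgroup of boundaries and the induced maps on homology\<close>

lemma reg_chains_diff: "c \<in> reg_chains P n \<Longrightarrow> d \<in> reg_chains P n \<Longrightarrow> c - d \<in> reg_chains P n"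
  unfolding reg_chains_def using Poly_Mapping.keys_diff[of c d] by fast

lemma zero_in_reg_chains: "0 \<in> reg_chains P n"
  by (simp add: reg_chains_def)

lemma wboundary_reg_chains: "c \<in> reg_chains P (Suc n) \<Longrightarrow> wboundary \<delta> (Suc n) c = reg_part (bd \<delta> c)"
  by (rule wboundary_eq) (auto simp: reg_chains_def)

lemma wboundaries_diff:
  assumes "b \<in> wboundaries P \<delta> n" "b' \<in> wboundaries P \<delta> n"
  shows "b - b' \<in> wboundaries P \<delta> n"
proof -
  obtain c d where c: "c \<in> Omega P \<delta> (Suc n)" "b = wboundary \<delta> (Suc n) c"
    and d: "d \<in> Omega P \<delta> (Suc n)" "b' = wboundary \<delta> (Suc n) d"
    using assms unfolding wboundaries_def by blast
  have *: "c \<in> reg_chains P (Suc n)" "d \<in> reg_chains P (Suc n)"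
    "wboundary \<delta> (Suc n) c \<in> reg_chains P n" "wboundary \<delta> (Suc n) d \<in> reg_chains P n"
    using c(1) d(1) by (simp_all add: Omega_def)
  have "wboundary \<delta> (Suc n) (c - d) = b - b'"
    using * reg_chains_diff[OF *(1,2)] by (simp add: c(2) d(2) wboundary_reg_chains)
  moreover have "c - d \<in> Omega P \<delta> (Suc n)"
    using * reg_chains_diff[OF *(1,2)] reg_chains_diff[OF *(3,4)] calculation
    by (simp add: Omega_def c(2) d(2))
  ultimately show ?thesis unfolding wboundaries_def by (metis imageI)
qed

lemma zero_in_wboundaries: "0 \<in> wboundaries P \<delta> n"
proof -
  have "wboundary \<delta> (Suc n) 0 = 0" by (simp add: wboundary_def)
  then have "0 \<in> Omega P \<delta> (Suc n)" by (simp add: Omega_def zero_in_reg_chains)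
  then show ?thesis
    unfolding wboundaries_def using \<open>wboundary \<delta> (Suc n) 0 = 0\<close> by (metis imageI)
qed

lemma wboundaries_uminus: "b \<in> wboundaries P \<delta> n \<Longrightarrow> - b \<in> wboundaries P \<delta> n"
  using wboundaries_diff[OF zero_in_wboundaries] by force

lemma wboundaries_add:
  "b \<in> wboundaries P \<delta> n \<Longrightarrow> b' \<in> wboundaries P \<delta> n \<Longrightarrow> b + b' \<in> wboundaries P \<delta> n"
  using wboundaries_diff[OF _ wboundaries_uminus] by force

lemma chain_map_reg_chains:
  assumes "\<And>p. p \<in> P \<Longrightarrow> map f p \<in> Q" "c \<in> reg_chains P n"
  shows "chain_map f c \<in> reg_chains Q n"
  using keys_reg_part[of "push (map f) c"] keys_push[of "map f" c] assms
  unfolding chain_map_eq reg_chains_def by fastforce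

lemma chain_map_wcycles:
  assumes P: "P \<subseteq> paths_on V" and f: "\<And>p. p \<in> P \<Longrightarrow> map f p \<in> Q"
    and wt: "\<And>x. x \<in> V \<Longrightarrow> \<epsilon> (f x) = \<delta> x" and z: "z \<in> wcycles P \<delta> n"
  shows "chain_map f z \<in> wcycles Q \<epsilon> n"
proof -
  have zr: "z \<in> reg_chains P n" and zb: "wboundary \<delta> n z = 0"
    using z by (simp_all add: wcycles_def Omega_def)
  note fz = chain_map_reg_chains[OF f zr]
  have "wboundary \<epsilon> n (chain_map f z) = 0"
  proof (cases n)
    case (Suc m)
    \<comment> \<open>Before regular parts are taken, a weight-preserving map commutes with the
      boundary exactly.\<close>
    have *: "bd \<epsilon> (push (map f) z) = push (map f) (bd \<delta> z)"
    proof (rule additive_eqI[where S = "\<lambda>z. bd \<epsilon> (push (map f) z)"])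
      fix p r assume "p \<in> Poly_Mapping.keys z"
      then have "set p \<subseteq> V" using zr P by (auto simp: reg_chains_def paths_on_def)
      then show "bd \<epsilon> (push (map f) (single p r)) = push (map f) (bd \<delta> (single p r))"
        using wt by (simp add: path_bd_map subset_eq)
    qed (simp_all add: additive_def)
    have "wboundary \<epsilon> n (chain_map f z) = reg_part (bd \<epsilon> (push (map f) z))"
      using fz unfolding Suc by (simp add: wboundary_reg_chains chain_map_eq reg_bd_reg)
    also have "\<dots> = reg_part (push (map f) (reg_part (bd \<delta> z)))"
      by (simp add: * reg_push_map_reg)
    also have "reg_part (bd \<delta> z) = 0"
      using zr zb unfolding Suc by (simp add: wboundary_reg_chains)
    finally show ?thesis by simp
  qed (simp add: wboundary_def)
  then show ?thesis using fz by (simp add: wcycles_def Omega_def zero_in_reg_chains)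
qed

text \<open>The bounding chain is the regular part of the prism over \<open>z\<close>. Its boundary
  is exactly the difference of the two images, which is supported in \<open>Q\<close>; this also
  gives the membership in \<open>Omega\<close>.\<close>

lemma chain_map_homologous:
  assumes P: "P \<subseteq> paths_on V"
    and f: "\<And>p. p \<in> P \<Longrightarrow> map f p \<in> Q" and g: "\<And>p. p \<in> P \<Longrightarrow> map g p \<in> Q"
    and prism: "\<And>l x m. l @ x # m \<in> P \<Longrightarrow> map f (l @ [x]) @ map g (x # m) \<in> Q"
    and wt: "\<And>x. x \<in> V \<Longrightarrow> \<epsilon> (f x) = \<delta> x \<and> \<epsilon> (g x) = \<delta> x \<and> \<delta> x dvd 1"
    and z: "z \<in> wcycles P \<delta> n"
  shows "chain_map g z - chain_map f z \<in> wboundaries Q \<epsilon> n"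
proof -
  have zr: "z \<in> reg_chains P n" and zb: "wboundary \<delta> n z = 0"
    using z by (simp_all add: wcycles_def Omega_def)
  have zk: "p \<in> P" "length p = Suc n" "set p \<subseteq> V" if "p \<in> Poly_Mapping.keys z" for p
    using that zr P by (auto simp: reg_chains_def paths_on_def)
  obtain u where u: "\<And>x. x \<in> V \<Longrightarrow> \<delta> x * u x = 1"
    using wt unfolding dvd_def by metis
  let ?L = "prism f g u"
  have hom: "bd \<epsilon> (?L z) + ?L (bd \<delta> z) = push (map g) z - push (map f) z"
  proof (rule additive_eqI[where S = "\<lambda>z. bd \<epsilon> (?L z) + ?L (bd \<delta> z)"])
    fix p r assume "p \<in> Poly_Mapping.keys z"
    from zk(3)[OF this] have "x \<in> V" if "x \<in> set p" for x using that by blast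
    then show "bd \<epsilon> (?L (single p r)) + ?L (bd \<delta> (single p r)) =
        push (map g) (single p r) - push (map f) (single p r)"
      using wt u by (simp add: path_prism_homotopy)
  qed (simp_all add: additive_def algebra_simps)
  \<comment> \<open>In degree 0, \<open>bd \<delta> z\<close> is a multiple of the empty path, which
    the prism operator kills. In positive degree the cycle condition only says that the regular part
    of \<open>bd \<delta> z\<close> vanishes, and the prism respects this.\<close>
  have L0: "reg_part (?L (bd \<delta> z)) = 0"
  proof (cases n)
    case 0
    have "?L (bd \<delta> z) = 0"
    proof (rule additive_eqI[where S = "\<lambda>z. ?L (bd \<delta> z)" and T = "\<lambda>_. 0"])
      fix p r assume "p \<in> Poly_Mapping.keys z"
      then obtain x where "p = [x]" using zk(2) 0 by (metis length_0_conv length_Suc_conv)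
      then show "?L (bd \<delta> (single p r)) = 0" by simp
    qed (simp_all add: additive_def)
    then show ?thesis by simp
  next
    case (Suc m)
    have "reg_part (bd \<delta> z) = 0"
      using zr zb unfolding Suc by (simp add: wboundary_reg_chains)
    then show ?thesis using reg_prism_reg[of f g u "bd \<delta> z"] by simp
  qed
  have "Poly_Mapping.keys (?L z) \<subseteq> {p \<in> Q. length p = Suc (Suc n)}"
    unfolding prism_def
  proof (rule keys_extend, rule subsetI)
    fix p r q assume p: "p \<in> Poly_Mapping.keys z" and "q \<in> Poly_Mapping.keys (path_prism f g u p r)"
    then obtain l x m where "p = l @ x # m" "q = map f (l @ [x]) @ map g (x # m)"
      using keys_path_prism by blast
    then show "q \<in> {p \<in> Q. length p = Suc (Suc n)}"
      using zk(1,2)[OF p] prism by auto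
  qed
  then have Lr: "reg_part (?L z) \<in> reg_chains Q (Suc n)"
    using keys_reg_part[of "?L z"] by (auto simp: reg_chains_def)
  have bdL: "wboundary \<epsilon> (Suc n) (reg_part (?L z)) = chain_map g z - chain_map f z"
  proof -
    have "bd \<epsilon> (?L z) = push (map g) z - push (map f) z - ?L (bd \<delta> z)"
      using hom by (simp add: eq_diff_eq)
    then show ?thesis
      using L0 by (simp add: wboundary_reg_chains[OF Lr] reg_bd_reg chain_map_eq)
  qed
  moreover have "chain_map g z - chain_map f z \<in> reg_chains Q n"
    using reg_chains_diff chain_map_reg_chains[OF f zr] chain_map_reg_chains[OF g zr] by blast
  ultimately have "reg_part (?L z) \<in> Omega Q \<epsilon> (Suc n)" using Lr by (simp add: Omega_def)
  then show ?thesis unfolding wboundaries_def bdL[symmetric] by (rule imageI)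
qed

text \<open>Boundaries form a subgroup, so replacing a representative by a homologous one does not
  change the set of cycles homologous to it.\<close>

lemma hom_induced_eqI:
  assumes "\<And>z. z \<in> wcycles P \<delta> n \<Longrightarrow> (chain_map f z, chain_map g z) \<in> homologous Q \<epsilon> n"
  shows "hom_induced P \<delta> Q \<epsilon> f n = hom_induced P \<delta> Q \<epsilon> g n"
  unfolding hom_induced_def
proof (rule restrict_ext)
  fix X assume "X \<in> whomology P \<delta> n"
  then have X: "X \<subseteq> wcycles P \<delta> n"
    by (auto simp: whomology_def quotient_def homologous_def)
  have "(chain_map f z, y) \<in> homologous Q \<epsilon> n \<longleftrightarrow> (chain_map g z, y) \<in> homologous Q \<epsilon> n"
    if "z \<in> X" for z y
  proof -
    have fg: "chain_map f z \<in> wcycles Q \<epsilon> n" "chain_map g z \<in> wcycles Q \<epsilon> n"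
      "chain_map f z - chain_map g z \<in> wboundaries Q \<epsilon> n"
      using assms X that by (auto simp: homologous_def)
    have "chain_map f z - y \<in> wboundaries Q \<epsilon> n \<longleftrightarrow> chain_map g z - y \<in> wboundaries Q \<epsilon> n"
      using wboundaries_add[OF fg(3), of "chain_map g z - y"]
        wboundaries_diff[OF _ fg(3), of "chain_map f z - y"] by auto
    then show ?thesis using fg by (simp add: homologous_def)
  qed
  then show "homologous Q \<epsilon> n `` (chain_map f ` X) = homologous Q \<epsilon> n `` (chain_map g ` X)"
    by blast
qed

text \<open>The prism condition already makes \<open>f\<close> and \<open>g\<close> maps of path
  complexes: double the last vertex and drop \<open>g x\<close> at the end, or double the first
  vertex and drop \<open>f x\<close> at the front.\<close>

lemma hom_induced_prism:
  assumes P: "path_complex V P" and Q: "path_complex W Q"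
    and prism: "\<And>l x m. l @ x # m \<in> P \<Longrightarrow> map f (l @ [x]) @ map g (x # m) \<in> Q"
    and wt: "\<And>x. x \<in> V \<Longrightarrow> \<epsilon> (f x) = \<delta> x \<and> \<epsilon> (g x) = \<delta> x \<and> \<delta> x dvd 1"
  shows "hom_induced P \<delta> Q \<epsilon> f n = hom_induced P \<delta> Q \<epsilon> g n"
proof (rule hom_induced_eqI)
  have Pp: "P \<subseteq> paths_on V" using P by (simp add: path_complex_def)
  have Qd: "butlast q \<in> Q" "tl q \<in> Q" if "q \<in> Q" "length q \<ge> 2" for q
    using Q that by (simp_all add: path_complex_def)
  have fP: "map f p \<in> Q" if "p \<in> P" for p
  proof -
    have "p \<noteq> []" using that Pp by (auto simp: paths_on_def)
    then obtain l x where p: "p = l @ [x]" by (metis rev_exhaust)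
    then show ?thesis using prism[of l x "[]"] Qd(1)[of "map f p @ [g x]"] that
      by (simp add: butlast_append)
  qed
  have gP: "map g p \<in> Q" if "p \<in> P" for p
  proof -
    have "p \<noteq> []" using that Pp by (auto simp: paths_on_def)
    then obtain x m where p: "p = x # m" by (metis list.exhaust)
    then show ?thesis using prism[of "[]" x m] Qd(2)[of "f x # map g p"] that by simp
  qed
  fix z assume z: "z \<in> wcycles P \<delta> n"
  have "chain_map f z \<in> wcycles Q \<epsilon> n" "chain_map g z \<in> wcycles Q \<epsilon> n"
    by (rule chain_map_wcycles[OF Pp _ _ z]; use fP gP wt in simp)+
  moreover have "chain_map f z - chain_map g z \<in> wboundaries Q \<epsilon> n"
    using wboundaries_uminus[OF chain_map_homologous[OF Pp fP gP prism wt z]] by simp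
  ultimately show "(chain_map f z, chain_map g z) \<in> homologous Q \<epsilon> n"
    by (simp add: homologous_def)
qed

section \<open>Prism paths in the path complexes of a hypergraph\<close>

text \<open>A homotopy along the arrow \<open>(i, j)\<close> of \<open>I\<^sub>1\<close> enters only through the arrows below,
  with \<open>f\<close> its restriction to the origin \<open>i\<close> and \<open>g\<close> to the end \<open>j\<close>.\<close>

definition arrow_homotopy :: "'a dhg \<Rightarrow> 'b dhg \<Rightarrow> ('a \<Rightarrow> 'b) \<Rightarrow> ('a \<Rightarrow> 'b) \<Rightarrow> bool" where
  "arrow_homotopy G H f g \<longleftrightarrow>
     (\<forall>(A, B) \<in> arrows G. (f ` A, f ` B) \<in> arrows H \<and> (g ` A, g ` B) \<in> arrows H) \<and>
     (\<forall>C \<in> P01 G. (f ` C, g ` C) \<in> arrows H)"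

lemma arrow_homotopyD:
  assumes "arrow_homotopy G H f g"
  shows "(A, B) \<in> arrows G \<Longrightarrow> (f ` A, f ` B) \<in> arrows H"
    "(A, B) \<in> arrows G \<Longrightarrow> (g ` A, g ` B) \<in> arrows H"
    "C \<in> P01 G \<Longrightarrow> (f ` C, g ` C) \<in> arrows H"
  using assms unfolding arrow_homotopy_def by auto

text \<open>Arrows cover all vertices, so \<open>x\<close> lies in some \<open>C\<close> in
  \<open>P01 G\<close>, and the arrow from \<open>f\<close> C\<open>to\<close>g \<open>C\<close>
  provides the middle step of a prism path.\<close>

lemma arrow_homotopy_vertex:
  assumes "dir_hypergraph G" "arrow_homotopy G H f g" "x \<in> verts G"
  obtains A B where "(A, B) \<in> arrows H" "f x \<in> A" "g x \<in> B"
proof -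
  obtain C where "C \<in> P01 G" "x \<in> C"
    using dir_hypergraph_vertexE[OF assms(1,3)] dir_hypergraph_arrowD(6,7)[OF assms(1)]
    by (metis UnE)
  then show thesis using that[of "f ` C" "g ` C"] arrow_homotopyD(3)[OF assms(2)] by blast
qed

lemma arrow_homotopy_verts:
  assumes "dir_hypergraph G" "dir_hypergraph H" "arrow_homotopy G H f g" "x \<in> verts G"
  shows "f x \<in> verts H" "g x \<in> verts H"
  using arrow_homotopy_vertex[OF assms(1,3,4)] dir_hypergraph_arrowD(4,5)[OF assms(2)]
  by (metis subsetD)+

section \<open>Prism paths in the complexes defined by consecutive vertices\<close>

lemma successively_prism:
  assumes "successively R (l @ x # m)"
    and "\<And>y z. R y z \<Longrightarrow> S (f y) (f z) \<and> S (g y) (g z)" and "S (f x) (g x)"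
  shows "successively S (map f (l @ [x]) @ map g (x # m))"
proof -
  have "successively R (l @ [x])" "successively R (x # m)"
    using assms(1) by (auto simp: successively_append_iff)
  then have "successively S (map f (l @ [x]))" "successively S (map g (x # m))"
    unfolding successively_map using assms(2) by (fastforce elim!: successively_mono)+
  then show ?thesis
    unfolding successively_append_iff[of S "map f (l @ [x])"] using assms(3) by simp
qed

lemma paths_on_prism:
  assumes "l @ x # m \<in> paths_on X" "f ` X \<subseteq> Y" "g ` X \<subseteq> Y"
  shows "map f (l @ [x]) @ map g (x # m) \<in> paths_on Y"
  using assms by (auto simp: paths_on_def image_subset_iff subset_iff)

lemma pc_C_prism:
  assumes G: "dir_hypergraph G" "dir_hypergraph H" and h: "arrow_homotopy G H f g"
    and p: "l @ x # m \<in> pc_C G"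
  shows "map f (l @ [x]) @ map g (x # m) \<in> pc_C H"
proof -
  have p1: "l @ x # m \<in> paths_on (verts G)"
    and p2: "successively (\<lambda>x y. x = y \<or> (\<exists>(A, B) \<in> arrows G. x \<in> A \<and> y \<in> B)) (l @ x # m)"
    using p by (simp_all add: pc_C_def)
  have x: "x \<in> verts G" using p1 by (simp add: paths_on_def)
  have "map f (l @ [x]) @ map g (x # m) \<in> paths_on (verts H)"
    by (rule paths_on_prism[OF p1]) (simp_all add: image_subset_iff arrow_homotopy_verts[OF G h])
  moreover have "successively (\<lambda>x y. x = y \<or> (\<exists>(A, B) \<in> arrows H. x \<in> A \<and> y \<in> B))
      (map f (l @ [x]) @ map g (x # m))" (is "successively ?S _")
  proof (rule successively_prism[OF p2])
    fix y z assume "y = z \<or> (\<exists>(A, B) \<in> arrows G. y \<in> A \<and> z \<in> B)"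
    then show "?S (f y) (f z) \<and> ?S (g y) (g z)"
    proof
      assume "\<exists>(A, B) \<in> arrows G. y \<in> A \<and> z \<in> B"
      then obtain A B where e: "(A, B) \<in> arrows G" and yz: "y \<in> A" "z \<in> B" by blast
      show ?thesis
        by (intro conjI disjI2 bexI[OF _ arrow_homotopyD(1)[OF h e]] bexI[OF _ arrow_homotopyD(2)[OF h e]])
          (simp_all add: yz)
    qed simp
  next
    obtain A B where "(A, B) \<in> arrows H" "f x \<in> A" "g x \<in> B"
      by (rule arrow_homotopy_vertex[OF G(1) h x])
    then show "?S (f x) (g x)" by blast
  qed
  ultimately show ?thesis by (simp add: pc_C_def)
qed

lemma pc_H2E_prism:
  assumes G: "dir_hypergraph G" "dir_hypergraph H" and h: "arrow_homotopy G H f g"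
    and p: "l @ x # m \<in> pc_H2E G"
  shows "map f (l @ [x]) @ map g (x # m) \<in> pc_H2E H"
proof -
  have p1: "l @ x # m \<in> paths_on (verts G)"
    and p2: "successively (\<lambda>x y. \<exists>(A, B) \<in> arrows G. x \<in> A \<union> B \<and> y \<in> A \<union> B) (l @ x # m)"
    using p by (simp_all add: pc_H2E_def)
  have x: "x \<in> verts G" using p1 by (simp add: paths_on_def)
  have "map f (l @ [x]) @ map g (x # m) \<in> paths_on (verts H)"
    by (rule paths_on_prism[OF p1]) (simp_all add: image_subset_iff arrow_homotopy_verts[OF G h])
  moreover have "successively (\<lambda>x y. \<exists>(A, B) \<in> arrows H. x \<in> A \<union> B \<and> y \<in> A \<union> B)
      (map f (l @ [x]) @ map g (x # m))" (is "successively ?S _")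
  proof (rule successively_prism[OF p2])
    fix y z assume "\<exists>(A, B) \<in> arrows G. y \<in> A \<union> B \<and> z \<in> A \<union> B"
    then obtain A B where e: "(A, B) \<in> arrows G" and yz: "y \<in> A \<union> B" "z \<in> A \<union> B" by blast
    have "k y \<in> k ` A \<union> k ` B \<and> k z \<in> k ` A \<union> k ` B" for k :: "'a \<Rightarrow> 'b"
      using yz by (simp flip: image_Un)
    then show "?S (f y) (f z) \<and> ?S (g y) (g z)"
      by (intro conjI bexI[OF _ arrow_homotopyD(1)[OF h e]] bexI[OF _ arrow_homotopyD(2)[OF h e]]) simp_all
  next
    obtain A B where "(A, B) \<in> arrows H" "f x \<in> A" "g x \<in> B"
      by (rule arrow_homotopy_vertex[OF G(1) h x])
    then show "?S (f x) (g x)" by blast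
  qed
  ultimately show ?thesis by (simp add: pc_H2E_def)
qed

section \<open>Block paths as an inductive predicate\<close>

text \<open>\<open>v\<^sub>i\<close> and \<open>w\<^sub>i\<close> are the ends of \<open>p\<^sub>i\<close> and \<open>p\<^sub>i\<^sub>+\<^sub>1\<close>, so a path of \<^term>\<open>pc_B G\<close> is the plain
  juxtaposition \<open>p\<^sub>0 p\<^sub>1 \<dots> p\<^sub>r\<^sub>+\<^sub>1\<close>. \<open>block_from G C p\<close> describes its tails \<open>p\<^sub>i \<dots> p\<^sub>r\<^sub>+\<^sub>1\<close>,
  where \<open>C\<close> is the set that \<open>p\<^sub>i\<close> has to stay in because of the preceding arrow.\<close>

inductive block_from :: "'a dhg \<Rightarrow> 'a set \<Rightarrow> 'a list \<Rightarrow> bool" for G where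
  final: "p \<in> paths_on C \<Longrightarrow> block_from G C p"
| step: "q \<in> paths_on C \<Longrightarrow> q \<in> paths_on A \<Longrightarrow> (A, B) \<in> arrows G \<Longrightarrow> block_from G B p \<Longrightarrow>
    block_from G C (q @ p)"

text \<open>Joining \<open>[v k, w k]\<close> appends only \<open>w k\<close>, and joining
  \<open>p (Suc k)\<close> then drops its head, which is that same vertex.\<close>

lemma zigzag_eq_concat:
  assumes "block_path G p v w A B r" "k \<le> Suc r"
  shows "zigzag p v w k = concat (map p [0..<Suc k])"
  using assms(2)
proof (induction k)
  case (Suc k)
  have "p (Suc k) \<noteq> []" "hd (p (Suc k)) = w k"
    using block_path_nonempty[OF assms(1)] block_pathD(8)[OF assms(1)] Suc.prems by simp_all
  then have "w k # tl (p (Suc k)) = p (Suc k)" by (metis list.collapse)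
  then show ?case using Suc by (simp add: path_concat_def)
qed simp

lemma block_path_imp_block_from:
  assumes z: "block_path G p v w A B r"
  shows "block_from G (A 0) (zigzag p v w (Suc r))"
proof -
  \<comment> \<open>Tails are built from the end of the path by downward induction on
    \<open>k\<close>.\<close>
  have tails: "block_from G (B k) (concat (map p [Suc k..<Suc (Suc r)]))" if "k \<le> r" for k
    using that
  proof (induction rule: inc_induct)
    case base
    then show ?case using block_pathD(3)[OF z] by (simp add: final)
  next
    case (step k)
    have "block_from G (B k) (p (Suc k) @ concat (map p [Suc (Suc k)..<Suc (Suc r)]))"
      by (rule block_from.step[where A = "A (Suc k)" and B = "B (Suc k)"])
        (use block_pathD[OF z] step in simp_all)
    moreover have "[Suc k..<Suc (Suc r)] = Suc k # [Suc (Suc k)..<Suc (Suc r)]"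
      using step by (simp add: upt_conv_Cons)
    ultimately show ?case by simp
  qed
  \<comment> \<open>No arrow precedes \<open>p 0\<close>, so \<open>A 0\<close> serves as both sets
    of the rule.\<close>
  have "block_from G (A 0) (p 0 @ concat (map p [Suc 0..<Suc (Suc r)]))"
    by (rule block_from.step[where A = "A 0" and B = "B 0"])
      (use block_pathD[OF z] tails[of 0] in simp_all)
  moreover have "[0..<Suc (Suc r)] = 0 # [Suc 0..<Suc (Suc r)]"
    by (simp add: upt_conv_Cons)
  ultimately show ?thesis using zigzag_eq_concat[OF z, of "Suc r"] by simp
qed

text \<open>A block path has at least one arrow, whereas \<open>block_from\<close> may have none;
  hence the extra piece \<open>q\<close> and arrow in front. The first set and piece are recorded so
  that the induction can check the junction when another piece is prepended.\<close>

lemma block_from_imp_block_path: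
  assumes "block_from G B p" "q \<in> paths_on A" "(A, B) \<in> arrows G"
  shows "\<exists>p' v w A' B' r. block_path G p' v w A' B' r \<and> A' 0 = A \<and> p' 0 = q \<and>
    zigzag p' v w (Suc r) = q @ p"
  using assms
proof (induction arbitrary: q A rule: block_from.induct)
  case (final p C)
  let ?p = "case_nat q (\<lambda>_. p)"
  have "last q \<in> A" "hd p \<in> C"
    using final(1,2) last_in_set[of q] hd_in_set[of p] by (simp_all add: paths_on_def subset_iff)
  then have z: "block_path G ?p (\<lambda>_. last q) (\<lambda>_. hd p) (\<lambda>_. A) (\<lambda>_. C) 0"
    by (intro block_pathI) (simp_all add: final)
  have "zigzag ?p (\<lambda>_. last q) (\<lambda>_. hd p) (Suc 0) = q @ p"
    unfolding zigzag_eq_concat[OF z order_refl] by simp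
  with z show ?case
    by (intro exI[of _ ?p] exI[of _ "\<lambda>_. last q"] exI[of _ "\<lambda>_. hd p"] exI[of _ "\<lambda>_. A"]
        exI[of _ "\<lambda>_. C"] exI[of _ 0]) simp
next
  case (step q' C A1 B p)
  obtain p' v w A' B' r where IH: "block_path G p' v w A' B' r" "A' 0 = A1" "p' 0 = q'"
      "zigzag p' v w (Suc r) = q' @ p"
    using step.IH[OF step.hyps(2,3)] by blast
  note z = IH(1)
  let ?p = "case_nat q p'" and ?v = "case_nat (last q) v" and ?w = "case_nat (hd q') w"
  \<comment> \<open>The head of \<open>q'\<close> witnesses that the end of the new arrow meets the
    origin of the next one.\<close>
  have q': "q' \<noteq> []" "hd q' \<in> C" "hd q' \<in> C \<inter> A1"
    using step.hyps(1,2) hd_in_set[of q'] by (auto simp: paths_on_def)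
  then have q'': "C \<inter> A1 \<noteq> {}" by blast
  have q: "last q \<in> A"
    using step.prems(1) last_in_set[of q] by (auto simp: paths_on_def)
  have z': "block_path G ?p ?v ?w (case_nat A A') (case_nat C B') (Suc r)"
  proof (rule block_pathI)
    show "case_nat C B' i \<inter> case_nat A A' (Suc i) \<noteq> {}" if "i < Suc r" for i
      using that q'' IH(2) block_pathD(9)[OF z] by (cases i) simp_all
    show "?p (Suc i) \<in> paths_on (case_nat A A' (Suc i))" if "i < Suc r" for i
      using that step.hyps IH(2,3) block_pathD(10)[OF z] by (cases i) simp_all
    show "?p (Suc i) \<in> paths_on (case_nat C B' i)" if "i \<le> Suc r" for i
      using that step.hyps IH(2,3) block_pathD(6)[OF z] by (cases i) simp_all
    show "(case_nat A A' i, case_nat C B' i) \<in> arrows G" if "i \<le> Suc r" for i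
      using that step.prems block_pathD(1)[OF z] by (cases i) simp_all
    show "?v i \<in> case_nat A A' i" if "i \<le> Suc r" for i
      using that q block_pathD(4)[OF z] by (cases i) simp_all
    show "?w i \<in> case_nat C B' i" if "i \<le> Suc r" for i
      using that q' block_pathD(5)[OF z] by (cases i) simp_all
    show "last (?p i) = ?v i" if "i \<le> Suc r" for i
      using that block_pathD(7)[OF z] by (cases i) simp_all
    show "hd (?p (Suc i)) = ?w i" if "i \<le> Suc r" for i
      using that IH(3) block_pathD(8)[OF z] by (cases i) simp_all
  qed (use step.prems in simp)
  have "[0..<Suc (Suc (Suc r))] = 0 # map Suc [0..<Suc (Suc r)]"
    by (simp only: map_Suc_upt) (simp add: upt_conv_Cons)
  then have "zigzag ?p ?v ?w (Suc (Suc r)) = q @ zigzag p' v w (Suc r)"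
    unfolding zigzag_eq_concat[OF z' order_refl] zigzag_eq_concat[OF z order_refl]
    by (simp only: list.map map_map comp_def concat.simps nat.case)
  with z' IH(4) show ?case
    by (intro exI[of _ ?p] exI[of _ ?v] exI[of _ ?w] exI[of _ "case_nat A A'"]
        exI[of _ "case_nat C B'"] exI[of _ "Suc r"]) simp
qed

text \<open>The rule \<open>final\<close> accounts for paths inside one set of \<open>P01 G\<close>,
  the rule \<open>step\<close> for paths crossing at least one arrow.\<close>

lemma pc_B_eq:
  assumes G: "dir_hypergraph G"
  shows "pc_B G = {p. \<exists>C \<in> P01 G. block_from G C p}"
proof (intro subset_antisym subsetI)
  fix p assume "p \<in> pc_B G"
  then consider C where "C \<in> P01 G" "p \<in> paths_on C"
    | q v w r A B where "p = zigzag q v w (Suc r)" "block_path G q v w A B r"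
    unfolding pc_B_def by blast
  then show "p \<in> {p. \<exists>C \<in> P01 G. block_from G C p}"
  proof cases
    case 1
    then show ?thesis using final by blast
  next
    case 2
    then show ?thesis
      using block_path_imp_block_from[OF 2(2)] block_pathD(1)[OF 2(2), of 0]
        dir_hypergraph_arrowD(6)[OF G] by blast
  qed
next
  fix p assume "p \<in> {p. \<exists>C \<in> P01 G. block_from G C p}"
  then obtain C where C: "C \<in> P01 G" "block_from G C p" by blast
  from C(2) show "p \<in> pc_B G"
  proof cases
    case final
    then show ?thesis using C(1) by (rule pc_B_P01I[rotated])
  next
    case (step q A B p')
    then show ?thesis using block_from_imp_block_path[OF step(5,3,4)] pc_B_block_pathI by metis
  qed
qed

lemma paths_on_map: "p \<in> paths_on X \<Longrightarrow> map f p \<in> paths_on (f ` X)"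
  by (auto simp: paths_on_def)

lemma block_from_map:
  assumes "block_from G C p" "\<And>A B. (A, B) \<in> arrows G \<Longrightarrow> (f ` A, f ` B) \<in> arrows H"
  shows "block_from H (f ` C) (map f p)"
  using assms(1)
proof induction
  case (final p C)
  then show ?case by (intro block_from.final paths_on_map)
next
  case (step q C A B p)
  then show ?case
    using block_from.step[OF paths_on_map[OF step(1)] paths_on_map[OF step(2)] assms(2)[OF step(3)]]
    by simp
qed

text \<open>Pieces before the doubled vertex are mapped by \<open>f\<close>, pieces after it by
  \<open>g\<close>. The piece containing it is cut in two, joined by an additional arrow from the
  \<open>f\<close>-image to the \<open>g\<close>-image of its set.\<close>

lemma block_from_prism:
  assumes G: "dir_hypergraph G" and h: "arrow_homotopy G H f g"
    and p: "block_from G C (l @ x # m)" and C: "C \<in> P01 G"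
  shows "block_from H (f ` C) (map f (l @ [x]) @ map g (x # m))"
  using p C
proof (induction "l @ x # m" arbitrary: l rule: block_from.induct)
  case (final C)
  have "map f (l @ [x]) \<in> paths_on (f ` C)" "map g (x # m) \<in> paths_on (g ` C)"
    using final by (auto simp: paths_on_def)
  then show ?case
    using arrow_homotopyD(3)[OF h final(2)] by (intro block_from.step block_from.final)
next
  case (step q C A B p)
  \<comment> \<open>The doubled vertex lies either in the remaining tail \<open>p\<close> or in the
    first piece \<open>q\<close>.\<close>
  consider l' where "l = q @ l'" "p = l' @ x # m" | m' where "q = l @ x # m'" "m = m' @ p"
    using step(6) step by (auto simp: append_eq_append_conv2 append_eq_Cons_conv)
  then show ?case
  proof cases
    case 1
    have "block_from H (f ` B) (map f (l' @ [x]) @ map g (x # m))"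
      using step.hyps(5)[OF 1(2)] dir_hypergraph_arrowD(7)[OF G step(3)] by simp
    then show ?thesis
      using block_from.step[OF paths_on_map[OF step(1)] paths_on_map[OF step(2)]
          arrow_homotopyD(1)[OF h step(3)]] 1 by simp
  next
    case 2
    have f: "map f (l @ [x]) \<in> paths_on (f ` C)" "map f (l @ [x]) \<in> paths_on (f ` A)"
      and g: "map g (x # m') \<in> paths_on (g ` A)"
      using step(1,2) 2 by (auto simp: paths_on_def)
    have "block_from H (g ` A) (map g (x # m') @ map g p)"
      using block_from.step[OF g g arrow_homotopyD(2)[OF h step(3)]]
        block_from_map[OF step(4) arrow_homotopyD(2)[OF h]] by blast
    then show ?thesis
      using block_from.step[OF f arrow_homotopyD(3)[OF h]] 2 dir_hypergraph_arrowD(6)[OF G step(3)]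
      by simp
  qed
qed

lemma pc_B_prism:
  assumes G: "dir_hypergraph G" "dir_hypergraph H" and h: "arrow_homotopy G H f g"
    and p: "l @ x # m \<in> pc_B G"
  shows "map f (l @ [x]) @ map g (x # m) \<in> pc_B H"
proof -
  obtain C where C: "C \<in> P01 G" "block_from G C (l @ x # m)"
    using p by (auto simp: pc_B_eq[OF G(1)])
  have "f ` C \<in> P01 H"
    using dir_hypergraph_arrowD(6)[OF G(2) arrow_homotopyD(3)[OF h C(1)]] .
  then show ?thesis
    using block_from_prism[OF G(1) h C(2,1)] by (auto simp: pc_B_eq[OF G(2)])
qed

section \<open>From homotopies of morphisms to equality on homology\<close>

lemma one_step_homotopic_arrow_homotopy:
  assumes G: "dir_hypergraph G" and "one_step_homotopic G H f0 f1"
  shows "arrow_homotopy G H (vmap f0) (vmap f1) \<or> arrow_homotopy G H (vmap f1) (vmap f0)"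
proof -
  obtain a F where a: "a \<in> {(0, 1), (1, 0)}" and F: "dhg_morphism (box_I G a) H F"
    and f: "restrict_end G 0 F = f0" "restrict_end G 1 F = f1"
    using assms(2) unfolding one_step_homotopic_def by blast
  have arr: "(vmap F ` A, vmap F ` B) \<in> arrows H" if "(A, B) \<in> arrows (box_I G a)" for A B
  proof -
    have "emap F (A, B) \<in> arrows H" "emap F (A, B) = (vmap F ` A, vmap F ` B)"
      using F that unfolding dhg_morphism_def by auto
    then show ?thesis by simp
  qed
  \<comment> \<open>The bound on \<open>A\<close> matters: \<open>restrict_end\<close> is
    \<open>undefined\<close> outside the vertices of \<open>G\<close>.\<close>
  have im: "vmap (restrict_end G i F) ` A = vmap F ` (A \<times> {i})" if "A \<subseteq> verts G" for A i
    using that by (force simp: restrict_end_def)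
  obtain i j where ij: "a = (i, j)" "i \<in> {0, 1}" "j \<in> {0, 1}" using a by auto
  have "arrow_homotopy G H (vmap (restrict_end G i F)) (vmap (restrict_end G j F))"
    unfolding arrow_homotopy_def
  proof (intro conjI ballI)
    fix e assume "e \<in> arrows G"
    moreover obtain A B where "e = (A, B)" by fastforce
    ultimately have e: "e = (A, B)" "(A, B) \<in> arrows G" by simp_all
    have "(A \<times> {k}, B \<times> {k}) \<in> arrows (box_I G a)" if "k \<in> {0, 1}" for k
      using e that by (auto simp: box_I_def)
    then show "case e of (A, B) \<Rightarrow>
        (vmap (restrict_end G i F) ` A, vmap (restrict_end G i F) ` B) \<in> arrows H \<and>
        (vmap (restrict_end G j F) ` A, vmap (restrict_end G j F) ` B) \<in> arrows H"
      using e ij arr dir_hypergraph_arrowD(4,5)[OF G e(2)] by (simp add: im)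
  next
    fix C assume C: "C \<in> P01 G"
    then have "(C \<times> {i}, C \<times> {j}) \<in> arrows (box_I G a)" by (auto simp: box_I_def ij(1))
    then show "(vmap (restrict_end G i F) ` C, vmap (restrict_end G j F) ` C) \<in> arrows H"
      using arr C by (simp add: im P01_def)
  qed
  \<comment> \<open>The two orientations of the interval give the two disjuncts.\<close>
  then show ?thesis using a f ij(1) by auto
qed

lemma hom_induced_arrow_homotopy:
  assumes G: "dir_hypergraph G" "dir_hypergraph H" and h: "arrow_homotopy G H f g"
    and wt: "\<And>x. x \<in> verts G \<Longrightarrow> \<epsilon> (f x) = \<delta> x \<and> \<epsilon> (g x) = \<delta> x \<and> \<delta> x dvd 1"
  shows "hom_induced (pc_C G) \<delta> (pc_C H) \<epsilon> f n = hom_induced (pc_C G) \<delta> (pc_C H) \<epsilon> g n"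
    and "hom_induced (pc_B G) \<delta> (pc_B H) \<epsilon> f n = hom_induced (pc_B G) \<delta> (pc_B H) \<epsilon> g n"
    and "hom_induced (pc_H2E G) \<delta> (pc_H2E H) \<epsilon> f n = hom_induced (pc_H2E G) \<delta> (pc_H2E H) \<epsilon> g n"
  using hom_induced_prism[OF path_complex_C path_complex_C pc_C_prism[OF G h] wt]
    hom_induced_prism[OF path_complex_B[OF G(1)] path_complex_B[OF G(2)] pc_B_prism[OF G h] wt]
    hom_induced_prism[OF path_complex_H2E path_complex_H2E pc_H2E_prism[OF G h] wt]
  by blast+

theorem theorem3p11:
  fixes G1 :: "'a dhg" and G2 :: "'b dhg"
    and \<delta>1 :: "'a \<Rightarrow> 'r::comm_ring_1" and \<delta>2 :: "'b \<Rightarrow> 'r"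
    and f g :: "('a, 'b) dhg_map" and n :: nat
  assumes "dir_hypergraph G1" and "dir_hypergraph G2"
    and "vertex_weighted_morphism G1 \<delta>1 G2 \<delta>2 f"
    and "vertex_weighted_morphism G1 \<delta>1 G2 \<delta>2 g"
    and "vw_homotopic G1 \<delta>1 G2 \<delta>2 f g"
    and "\<forall>k \<in> {k. \<exists>v \<in> verts G1. k = \<delta>1 v}. k dvd 1"
  shows "hom_induced (pc_C G1) \<delta>1 (pc_C G2) \<delta>2 (vmap f) n =
           hom_induced (pc_C G1) \<delta>1 (pc_C G2) \<delta>2 (vmap g) n \<and>
         hom_induced (pc_B G1) \<delta>1 (pc_B G2) \<delta>2 (vmap f) n =
           hom_induced (pc_B G1) \<delta>1 (pc_B G2) \<delta>2 (vmap g) n \<and>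
         hom_induced (pc_H2E G1) \<delta>1 (pc_H2E G2) \<delta>2 (vmap f) n =
           hom_induced (pc_H2E G1) \<delta>1 (pc_H2E G2) \<delta>2 (vmap g) n"
proof -
  let ?eq = "\<lambda>f g.
    hom_induced (pc_C G1) \<delta>1 (pc_C G2) \<delta>2 (vmap f) n =
      hom_induced (pc_C G1) \<delta>1 (pc_C G2) \<delta>2 (vmap g) n \<and>
    hom_induced (pc_B G1) \<delta>1 (pc_B G2) \<delta>2 (vmap f) n =
      hom_induced (pc_B G1) \<delta>1 (pc_B G2) \<delta>2 (vmap g) n \<and>
    hom_induced (pc_H2E G1) \<delta>1 (pc_H2E G2) \<delta>2 (vmap f) n =
      hom_induced (pc_H2E G1) \<delta>1 (pc_H2E G2) \<delta>2 (vmap g) n"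
  obtain N h where h: "h 0 = f" "h N = g"
    and vw: "\<And>k. k \<le> N \<Longrightarrow> vertex_weighted_morphism G1 \<delta>1 G2 \<delta>2 (h k)"
    and hom: "\<And>k. k < N \<Longrightarrow> one_step_homotopic G1 G2 (h k) (h (Suc k))"
    using assms(5) unfolding vw_homotopic_def by auto
  \<comment> \<open>All intermediate morphisms preserve weights, so the prism formula applies to
    each single step.\<close>
  have wt: "\<delta>2 (vmap (h k) x) = \<delta>1 x \<and> \<delta>2 (vmap (h l) x) = \<delta>1 x \<and> \<delta>1 x dvd 1"
    if "k \<le> N" "l \<le> N" "x \<in> verts G1" for k l x
    using vw[OF that(1)] vw[OF that(2)] that(3) assms(6)
    by (auto simp: vertex_weighted_morphism_def)
  have step: "?eq (h k) (h (Suc k))" if "k < N" for k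
    using one_step_homotopic_arrow_homotopy[OF assms(1) hom[OF that]]
  proof
    assume *: "arrow_homotopy G1 G2 (vmap (h k)) (vmap (h (Suc k)))"
    show ?thesis
      by (intro conjI hom_induced_arrow_homotopy[OF assms(1,2) *] wt) (use that in simp_all)
  next
    assume *: "arrow_homotopy G1 G2 (vmap (h (Suc k))) (vmap (h k))"
    show ?thesis
      by (intro conjI hom_induced_arrow_homotopy[OF assms(1,2) *, symmetric] wt) (use that in simp_all)
  qed
  have "?eq (h 0) (h k)" if "k \<le> N" for k
    using that
  proof (induction k)
    case (Suc k)
    then show ?case using step[of k] by simp
  qed simp
  from this[of N] show ?thesis by (simp add: h)
qed

end
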